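(* In any nominal transition system, for all states $P,Q$: if $P\stackrel{\cdot}{=}Q$ (they satisfy the same formulas) then $P\stackrel{\cdot}{\sim}Q$ (they are bisimilar).
   Context: Nominal sets over a countably infinite (possibly sorted) set of names $\mathcal N$: permutations fix all but finitely many names, every element has finite support $\operatorname{supp}$, $a\# X$ means $a\notin\operatorname{supp}(X)$; $[\mathcal P_{\mathrm{fin}}(\mathcal N)]S$ is $\mathcal P_{\mathrm{fin}}(\mathcal N)\times S$ modulo $(N,X)=_\alpha(N',X')$ iff some permutation $\pi$ with $\pi\cdot(N,X)=(N',X')$ fixes every name in $\operatorname{supp}(X)\setminus N$; classes $\langle N\rangle X$. A nominal transition system: nominal sets STATES, PRED, ACT; equivariant $\vdash\subseteq\mathrm{STATES}\times\mathrm{PRED}$; equivariant $\operatorname{bn}$, $\operatorname{bn}(\alpha)$ a finite subset of $\operatorname{supp}(\alpha)$; equivariant $\rightarrow\ \subseteq\mathrm{STATES}\times[\mathcal P_{\mathrm{fin}}(\mathcal N)](\mathrm{ACT}\times\mathrm{STATES})$ with $(P,\langle N\rangle(\alpha,Q))\in\rightarrow$ only if $N=\operatorname{bn}(\alpha)$; $P\xrightarrow{\alpha}P'$ means $(P,\langle\operatorname{bn}(\alpha)\rangle(\alpha,P'))\in\rightarrow$. A bisimulation is a symmetric relation $R$ on states with: $R(P,Q)$ implies (1) $P\vdash\varphi\Rightarrow Q\vdash\varphi$ for all $\varphi$, (2) whenever $\operatorname{bn}(\alpha)\# Q$ and $P\xrightarrow{\alpha}P'$ there is $Q'$ with $Q\xrightarrow{\alpha}Q'$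 and $R(P',Q')$. $P\stackrel{\cdot}{\sim}Q$ iff some bisimulation relates them. Formulas: fix an infinite cardinal $\kappa>\aleph_0$ with $\kappa>|\mathrm{STATES}|$; formulas are $\bigwedge_{i\in I}A_i$ (with $\{A_i\mid i\in I\}$ of cardinality $<\kappa$ and finitely supported), $\neg A$, $\varphi\in\mathrm{PRED}$, $\langle\alpha\rangle A$ with $\operatorname{bn}(\alpha)$ bound in $\alpha$ and $A$ ($\operatorname{supp}(\langle\alpha\rangle A)=\operatorname{supp}(\alpha,A)\setminus\operatorname{bn}(\alpha)$). Satisfaction: $P\models\bigwedge A_i$ iff all $P\models A_i$; $P\models\neg A$ iff not $P\models A$; $P\models\varphi$ iff $P\vdash\varphi$; $P\models\langle\alpha\rangle A$ iff for a representative with $\operatorname{bn}(\alpha)\# P$ some $P'$ has $P\xrightarrow{\alpha}P'$ and $P'\models A$. $P\stackrel{\cdot}{=}Q$ iff for all formulas $A$, $P\models A\iff Q\models A$. *)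

theory Defs
  imports "HOL-Combinatorics.Perm" "HOL-Library.Countable_Set"
begin

unbundle cardinal_syntax
notation Perm.apply (infixl \<open>\<langle>$\<rangle>\<close> 999)

section \<open>Nominal sets\<close>

text \<open>
  The elements of the library type \<open>'n perm\<close> are exactly the bijections that fix all but finitely
  many names. Names are sorted by a function \<open>srt\<close>, and permutations have to respect sorts; a constant
  \<open>srt\<close> gives the unsorted case. A nominal set is a carrier together with an action, whose
  behaviour outside the carrier and on permutations that do not respect sorts is irrelevant.
\<close>

definition perms :: "('n \<Rightarrow> 's) \<Rightarrow> 'n perm set" where
  "perms srt = {p. \<forall>a. srt (p \<langle>$\<rangle> a) = srt a}"

definition supports :: "('n \<Rightarrow> 's) \<Rightarrow> ('n perm \<Rightarrow> 'x \<Rightarrow> 'x) \<Rightarrow> 'n set \<Rightarrow> 'x \<Rightarrow> bool" where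
  "supports srt act S x \<longleftrightarrow> (\<forall>p\<in>perms srt. (\<forall>a\<in>S. p \<langle>$\<rangle> a = a) \<longrightarrow> act p x = x)"

definition finitely_supported :: "('n \<Rightarrow> 's) \<Rightarrow> ('n perm \<Rightarrow> 'x \<Rightarrow> 'x) \<Rightarrow> 'x \<Rightarrow> bool" where
  "finitely_supported srt act x \<longleftrightarrow> (\<exists>S. finite S \<and> supports srt act S x)"

text \<open>
  Since every sort is infinite, the finite supporting sets of an element are closed under
  intersection, so the following is the least finite supporting set whenever there is a finite one.
\<close>

definition supp :: "('n \<Rightarrow> 's) \<Rightarrow> ('n perm \<Rightarrow> 'x \<Rightarrow> 'x) \<Rightarrow> 'x \<Rightarrow> 'n set" where
  "supp srt act x = \<Inter>{S. finite S \<and> supports srt act S x}"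

definition nominal_set :: "('n \<Rightarrow> 's) \<Rightarrow> 'x set \<Rightarrow> ('n perm \<Rightarrow> 'x \<Rightarrow> 'x) \<Rightarrow> bool" where
  "nominal_set srt X act \<longleftrightarrow>
     (\<forall>p\<in>perms srt. \<forall>x\<in>X. act p x \<in> X) \<and>
     (\<forall>x\<in>X. act 1 x = x) \<and>
     (\<forall>p\<in>perms srt. \<forall>q\<in>perms srt. \<forall>x\<in>X. act (p * q) x = act p (act q x)) \<and>
     (\<forall>x\<in>X. finitely_supported srt act x)"

definition prod_act ::
    "('n perm \<Rightarrow> 'x \<Rightarrow> 'x) \<Rightarrow> ('n perm \<Rightarrow> 'y \<Rightarrow> 'y) \<Rightarrow> 'n perm \<Rightarrow> 'x \<times> 'y \<Rightarrow> 'x \<times> 'y" where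
  "prod_act act act' p = map_prod (act p) (act' p)"

definition set_act :: "('n perm \<Rightarrow> 'x \<Rightarrow> 'x) \<Rightarrow> 'n perm \<Rightarrow> 'x set \<Rightarrow> 'x set" where
  "set_act act p = image (act p)"

text \<open>The abstraction \<open>\<langle>N\<rangle>X\<close>, as the set of all pairs alpha-equivalent to \<open>(N, X)\<close>.\<close>

definition alpha_eq ::
    "('n \<Rightarrow> 's) \<Rightarrow> ('n perm \<Rightarrow> 'x \<Rightarrow> 'x) \<Rightarrow> 'n set \<times> 'x \<Rightarrow> 'n set \<times> 'x \<Rightarrow> bool" where
  "alpha_eq srt act = (\<lambda>(N, X) (N', X').
     \<exists>p\<in>perms srt. prod_act (set_act Perm.apply) act p (N, X) = (N', X') \<and>
       (\<forall>a\<in>supp srt act X - N. p \<langle>$\<rangle> a = a))"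

definition abstraction ::
    "('n \<Rightarrow> 's) \<Rightarrow> ('n perm \<Rightarrow> 'x \<Rightarrow> 'x) \<Rightarrow> 'n set \<Rightarrow> 'x \<Rightarrow> ('n set \<times> 'x) set" where
  "abstraction srt act N X = {Y. alpha_eq srt act (N, X) Y}"

definition abstractions ::
    "('n \<Rightarrow> 's) \<Rightarrow> 'x set \<Rightarrow> ('n perm \<Rightarrow> 'x \<Rightarrow> 'x) \<Rightarrow> ('n set \<times> 'x) set set" where
  "abstractions srt S act = {abstraction srt act N X | N X. finite N \<and> X \<in> S}"

abbreviation abstraction_act ::
    "('n perm \<Rightarrow> 'x \<Rightarrow> 'x) \<Rightarrow> 'n perm \<Rightarrow> ('n set \<times> 'x) set \<Rightarrow> ('n set \<times> 'x) set" where
  "abstraction_act act \<equiv> set_act (prod_act (set_act Perm.apply) act)"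


section \<open>Nominal transition systems and bisimilarity\<close>

locale nominal_transition_system =
  fixes srt :: "'n \<Rightarrow> 's"
    and STATES :: "'st set" and actS :: "'n perm \<Rightarrow> 'st \<Rightarrow> 'st"
    and PRED :: "'p set" and actP :: "'n perm \<Rightarrow> 'p \<Rightarrow> 'p"
    and ACT :: "'a set" and actA :: "'n perm \<Rightarrow> 'a \<Rightarrow> 'a"
    and entails :: "('st \<times> 'p) set"
    and bn :: "'a \<Rightarrow> 'n set"
    and trans :: "('st \<times> ('n set \<times> 'a \<times> 'st) set) set"
  assumes countable_names: "countable (UNIV :: 'n set)"
    and infinite_sorts: "infinite {b. srt b = srt a}"
    and nominal_STATES: "nominal_set srt STATES actS"
    and nominal_PRED: "nominal_set srt PRED actP"
    and nominal_ACT: "nominal_set srt ACT actA"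
    and entails_subset: "entails \<subseteq> STATES \<times> PRED"
    and entails_eqvt: "p \<in> perms srt \<Longrightarrow> (P, \<phi>) \<in> entails \<Longrightarrow> (actS p P, actP p \<phi>) \<in> entails"
    and finite_bn: "\<alpha> \<in> ACT \<Longrightarrow> finite (bn \<alpha>)"
    and bn_subset: "\<alpha> \<in> ACT \<Longrightarrow> bn \<alpha> \<subseteq> supp srt actA \<alpha>"
    and bn_eqvt: "p \<in> perms srt \<Longrightarrow> \<alpha> \<in> ACT \<Longrightarrow> bn (actA p \<alpha>) = set_act Perm.apply p (bn \<alpha>)"
    and trans_subset: "trans \<subseteq> STATES \<times> abstractions srt (ACT \<times> STATES) (prod_act actA actS)"
    and trans_eqvt: "p \<in> perms srt \<Longrightarrow> (P, C) \<in> trans \<Longrightarrow>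
      (actS p P, abstraction_act (prod_act actA actS) p C) \<in> trans"
    and trans_bn: "finite N \<Longrightarrow> \<alpha> \<in> ACT \<Longrightarrow> Q \<in> STATES \<Longrightarrow>
      (P, abstraction srt (prod_act actA actS) N (\<alpha>, Q)) \<in> trans \<Longrightarrow> N = bn \<alpha>"
begin

definition step :: "'st \<Rightarrow> 'a \<Rightarrow> 'st \<Rightarrow> bool" where
  "step P \<alpha> P' \<longleftrightarrow> \<alpha> \<in> ACT \<and> P' \<in> STATES \<and>
     (P, abstraction srt (prod_act actA actS) (bn \<alpha>) (\<alpha>, P')) \<in> trans"

definition fresh :: "'n set \<Rightarrow> 'st \<Rightarrow> bool" where
  "fresh N P \<longleftrightarrow> (\<forall>a\<in>N. a \<notin> supp srt actS P)"

definition bisimulation :: "('st \<Rightarrow> 'st \<Rightarrow> bool) \<Rightarrow> bool" where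
  "bisimulation R \<longleftrightarrow>
     (\<forall>P Q. R P Q \<longrightarrow> P \<in> STATES \<and> Q \<in> STATES) \<and> symp R \<and>
     (\<forall>P Q. R P Q \<longrightarrow>
        (\<forall>\<phi>\<in>PRED. (P, \<phi>) \<in> entails \<longrightarrow> (Q, \<phi>) \<in> entails) \<and>
        (\<forall>\<alpha>\<in>ACT. \<forall>P'. fresh (bn \<alpha>) Q \<and> step P \<alpha> P' \<longrightarrow> (\<exists>Q'. step Q \<alpha> Q' \<and> R P' Q')))"

definition bisimilar :: "'st \<Rightarrow> 'st \<Rightarrow> bool" where
  "bisimilar P Q \<longleftrightarrow> (\<exists>R. bisimulation R \<and> R P Q)"

end


section \<open>Formulas and satisfaction\<close>

text \<open>
  A formula is represented by the set of all raw trees denoting it, so that formulas are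
  identified up to alpha-equivalence and a conjunction depends only on the set of its conjuncts.
  Raw conjunctions are families indexed by subsets of \<open>'k\<close>, the type carrying the
  cardinal \<open>\<kappa>\<close>; every set of fewer than \<open>\<kappa>\<close> trees is the range of such a family.
\<close>

datatype ('k, 'p, 'a) raw =
    RConj "'k \<Rightarrow> ('k, 'p, 'a) raw option"
  | RNeg "('k, 'p, 'a) raw"
  | RPred 'p
  | RAct 'a "('k, 'p, 'a) raw"

inductive_set raw_sub :: "(('k, 'p, 'a) raw \<times> ('k, 'p, 'a) raw) set" where
  "r \<in> ran F \<Longrightarrow> (r, RConj F) \<in> raw_sub"
| "(r, RNeg r) \<in> raw_sub"
| "(r, RAct \<alpha> r) \<in> raw_sub"

lemma wf_raw_sub: "wf (raw_sub :: (('k, 'p, 'a) raw \<times> _) set)"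
proof (rule wfUNIVI)
  fix P :: "('k, 'p, 'a) raw \<Rightarrow> bool" and r
  assume "\<forall>x. (\<forall>y. (y, x) \<in> raw_sub \<longrightarrow> P y) \<longrightarrow> P x"
  then have step: "P x" if "\<And>y. (y, x) \<in> raw_sub \<Longrightarrow> P y" for x
    using that by blast
  show "P r"
  proof (induction r)
    case (RConj F)
    show ?case
    proof (rule step)
      fix y assume "(y, RConj F) \<in> raw_sub"
      then show "P y"
      proof cases
        case 1
        then obtain k where "F k = Some y" by (auto simp: ran_def)
        then have "Some y \<in> range F" by (metis rangeI)
        then show ?thesis by (rule RConj.IH) simp
      qed
    qed
  next
    case (RNeg r)
    show ?case by (rule step) (use RNeg in \<open>auto elim: raw_sub.cases\<close>)
  next
    case (RPred \<phi>)
    show ?case by (rule step) (auto elim: raw_sub.cases)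
  next
    case (RAct \<alpha> r)
    show ?case by (rule step) (use RAct in \<open>auto elim: raw_sub.cases\<close>)
  qed
qed

lemma raw_sub_map: "(r, s) \<in> raw_sub \<Longrightarrow> (map_raw f g r, map_raw f g s) \<in> raw_sub"
  by (induction rule: raw_sub.induct) (fastforce simp: ran_def intro!: raw_sub.intros)+

locale nominal_logic = nominal_transition_system srt STATES actS PRED actP ACT actA entails bn trans
  for srt :: "'n \<Rightarrow> 's"
    and STATES :: "'st set" and actS :: "'n perm \<Rightarrow> 'st \<Rightarrow> 'st"
    and PRED :: "'p set" and actP :: "'n perm \<Rightarrow> 'p \<Rightarrow> 'p"
    and ACT :: "'a set" and actA :: "'n perm \<Rightarrow> 'a \<Rightarrow> 'a"
    and entails :: "('st \<times> 'p) set"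
    and bn :: "'a \<Rightarrow> 'n set"
    and trans :: "('st \<times> ('n set \<times> 'a \<times> 'st) set) set" +
  fixes \<kappa> :: "'k rel"
  assumes card_order_kappa: "Card_order \<kappa>"
    and natLeq_less_kappa: "natLeq <o \<kappa>"
    and STATES_less_kappa: "|STATES| <o \<kappa>"
begin

definition form_act :: "'n perm \<Rightarrow> ('k, 'p, 'a) raw set \<Rightarrow> ('k, 'p, 'a) raw set" where
  "form_act = set_act (\<lambda>p. map_raw (actP p) (actA p))"

definition Conj :: "('k, 'p, 'a) raw set set \<Rightarrow> ('k, 'p, 'a) raw set" where
  "Conj \<A> = {RConj F | F. ran F \<subseteq> \<Union>\<A> \<and> (\<forall>A\<in>\<A>. ran F \<inter> A \<noteq> {})}"

definition Neg :: "('k, 'p, 'a) raw set \<Rightarrow> ('k, 'p, 'a) raw set" where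
  "Neg A = RNeg ` A"

definition Pred :: "'p \<Rightarrow> ('k, 'p, 'a) raw set" where
  "Pred \<phi> = {RPred \<phi>}"

definition Act :: "'a \<Rightarrow> ('k, 'p, 'a) raw set \<Rightarrow> ('k, 'p, 'a) raw set" where
  "Act \<alpha> A = {RAct \<beta> r | N \<beta> B r.
     (N, \<beta>, B) \<in> abstraction srt (prod_act actA form_act) (bn \<alpha>) (\<alpha>, A) \<and> r \<in> B}"

inductive_set formulas :: "('k, 'p, 'a) raw set set" where
  Conj: "\<forall>A\<in>\<A>. A \<in> formulas \<Longrightarrow> |\<A>| <o \<kappa> \<Longrightarrow> finitely_supported srt (set_act form_act) \<A> \<Longrightarrow>
    Conj \<A> \<in> formulas"
| Neg: "A \<in> formulas \<Longrightarrow> Neg A \<in> formulas"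
| Pred: "\<phi> \<in> PRED \<Longrightarrow> Pred \<phi> \<in> formulas"
| Act: "\<alpha> \<in> ACT \<Longrightarrow> A \<in> formulas \<Longrightarrow> Act \<alpha> A \<in> formulas"

lemma formulas_nonempty: "A \<in> formulas \<Longrightarrow> A \<noteq> {}"
proof (induction rule: formulas.induct)
  case (Conj \<A>)
  have "|\<A>| \<le>o |Field \<kappa>|"
    using Conj(2) card_order_kappa
    by (meson card_of_Field_ordIso ordIso_symmetric ordLeq_ordIso_trans ordLess_imp_ordLeq)
  then obtain f :: "_ \<Rightarrow> 'k" where f: "inj_on f \<A>"
    using card_of_ordLeq[of \<A> "Field \<kappa>"] by auto
  define F where "F k = (if k \<in> f ` \<A> then Some (SOME r. r \<in> inv_into \<A> f k) else None)" for k
  have F: "F (f A) = Some (SOME r. r \<in> A)" if "A \<in> \<A>" for A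
    using that f by (simp add: F_def)
  have ran: "ran F = {SOME r. r \<in> A | A. A \<in> \<A>}"
  proof (intro set_eqI iffI)
    fix r assume "r \<in> ran F"
    then obtain k where k: "F k = Some r" by (auto simp: ran_def)
    then obtain A where "A \<in> \<A>" "k = f A" by (auto simp: F_def split: if_splits)
    with k F show "r \<in> {SOME r. r \<in> A | A. A \<in> \<A>}" by auto
  qed (use F in \<open>auto intro: ranI\<close>)
  have "(SOME r. r \<in> A) \<in> A" if "A \<in> \<A>" for A
    using Conj that by (meson ex_in_conv someI_ex)
  with ran have "ran F \<subseteq> \<Union>\<A> \<and> (\<forall>A\<in>\<A>. ran F \<inter> A \<noteq> {})"
    by fastforce
  then have "RConj F \<in> Conj \<A>"
    by (simp add: Conj_def)
  then show ?case by blast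
next
  case (Act \<alpha> A)
  have "map_raw (actP 1) (actA 1) ` A \<noteq> {}"
    using Act by simp
  then obtain r where "r \<in> form_act 1 A"
    by (auto simp: form_act_def set_act_def)
  moreover have "actA 1 \<alpha> = \<alpha>" "1 \<in> perms srt"
    using nominal_ACT Act by (auto simp: nominal_set_def perms_def)
  then have "(bn \<alpha>, \<alpha>, form_act 1 A) \<in> abstraction srt (prod_act actA form_act) (bn \<alpha>) (\<alpha>, A)"
    unfolding abstraction_def alpha_eq_def mem_Collect_eq prod.case
    by (intro bexI[of _ 1]) (simp_all add: prod_act_def set_act_def)
  ultimately show ?case
    unfolding Act_def by blast
qed (auto simp: Neg_def Pred_def)

text \<open>
  Forgetting all labels makes a tree invariant under permutations, so that the immediate
  subformula relation is well-founded on formulas up to alpha-equivalence.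
\<close>

definition shape :: "('k, 'p, 'a) raw \<Rightarrow> ('k, unit, unit) raw" where
  "shape = map_raw (\<lambda>_. ()) (\<lambda>_. ())"

definition subformula_rel :: "(('k, 'p, 'a) raw set \<times> ('k, 'p, 'a) raw set) set" where
  "subformula_rel = {(A, X). A \<in> formulas \<and> (\<forall>r\<in>X. \<exists>s\<in>A. (shape s, shape r) \<in> raw_sub)}"

lemma wf_subformula_rel: "wf subformula_rel"
proof (rule wfUNIVI)
  fix P :: "('k, 'p, 'a) raw set \<Rightarrow> bool" and X
  assume "\<forall>X. (\<forall>A. (A, X) \<in> subformula_rel \<longrightarrow> P A) \<longrightarrow> P X"
  then have step: "P X" if "\<And>A. (A, X) \<in> subformula_rel \<Longrightarrow> P A" for X
    using that by blast
  have *: "P X" if "r \<in> X" for r X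
    using that
  proof (induction "shape r" arbitrary: r X rule: wf_induct_rule[OF wf_raw_sub])
    case 1
    show ?case
    proof (rule step)
      fix A assume "(A, X) \<in> subformula_rel"
      with 1(2) obtain s where "s \<in> A" "(shape s, shape r) \<in> raw_sub"
        by (auto simp: subformula_rel_def)
      then show "P A" by (intro 1(1)[of s])
    qed
  qed
  show "P X"
  proof (rule step)
    fix A assume "(A, X) \<in> subformula_rel"
    then have "A \<noteq> {}" by (simp add: subformula_rel_def formulas_nonempty)
    with * show "P A" by auto
  qed
qed

lemma subformula_relI:
  "A \<in> formulas \<Longrightarrow> A \<in> \<A> \<Longrightarrow> (A, Conj \<A>) \<in> subformula_rel"
  "A \<in> formulas \<Longrightarrow> (A, Neg A) \<in> subformula_rel"
  "A \<in> formulas \<Longrightarrow> (A, Act \<alpha> A) \<in> subformula_rel"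
proof -
  assume A: "A \<in> formulas"
  show "(A, Conj \<A>) \<in> subformula_rel" if in_conj: "A \<in> \<A>"
    unfolding subformula_rel_def
  proof (clarsimp simp: A)
    fix r assume "r \<in> Conj \<A>"
    then obtain F where "r = RConj F" "ran F \<inter> A \<noteq> {}"
      using in_conj by (auto simp: Conj_def)
    then obtain s where "r = RConj F" "s \<in> ran F" "s \<in> A"
      by blast
    then show "\<exists>s\<in>A. (shape s, shape r) \<in> raw_sub"
      unfolding shape_def by (metis raw_sub_map raw_sub.intros(1))
  qed
  show "(A, Neg A) \<in> subformula_rel"
    unfolding subformula_rel_def
  proof (clarsimp simp: A)
    fix r assume "r \<in> Neg A"
    then show "\<exists>s\<in>A. (shape s, shape r) \<in> raw_sub"
      unfolding shape_def Neg_def by (metis imageE raw_sub_map raw_sub.intros(2))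
  qed
  have shape: "shape (map_raw f g r) = shape r" for f g r
    by (simp add: shape_def raw.map_comp comp_def)
  show "(A, Act \<alpha> A) \<in> subformula_rel"
    unfolding subformula_rel_def
  proof (clarsimp simp: A)
    fix r assume "r \<in> Act \<alpha> A"
    then obtain p \<beta> s where "r = RAct \<beta> (map_raw (actP p) (actA p) s)" "s \<in> A"
      by (auto simp: Act_def abstraction_def alpha_eq_def prod_act_def form_act_def set_act_def)
    moreover have "(shape t, shape (RAct \<beta> t)) \<in> raw_sub" for t
      unfolding shape_def by (intro raw_sub_map raw_sub.intros)
    ultimately show "\<exists>s\<in>A. (shape s, shape r) \<in> raw_sub"
      by (metis shape)
  qed
qed

lemmas [fundef_cong] = conj_cong

text \<open>
  Each formula matches exactly one of the four disjuncts, and the usual clauses follow from freeness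
  of the constructors (\<open>sat_Conj\<close>, \<open>sat_Neg\<close>, \<open>sat_Pred\<close>, \<open>sat_Act\<close> below). In the last disjunct, \<open>\<alpha>\<close> and \<open>A\<close> range over
  all representatives of the formula with \<open>bn \<alpha>\<close> fresh for the state.
\<close>

function sat :: "'st \<Rightarrow> ('k, 'p, 'a) raw set \<Rightarrow> bool" where
  "sat P X \<longleftrightarrow>
     (\<exists>\<A>. X = Conj \<A> \<and> \<A> \<subseteq> formulas \<and> (\<forall>A\<in>\<A>. sat P A)) \<or>
     (\<exists>A. X = Neg A \<and> A \<in> formulas \<and> \<not> sat P A) \<or>
     (\<exists>\<phi>\<in>PRED. X = Pred \<phi> \<and> (P, \<phi>) \<in> entails) \<or>
     (\<exists>\<alpha>\<in>ACT. \<exists>A. X = Act \<alpha> A \<and> A \<in> formulas \<and> fresh (bn \<alpha>) P \<and>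
        (\<exists>P'. step P \<alpha> P' \<and> sat P' A))"
  by pat_completeness (elim Pair_inject, simp only:)
termination
  apply (relation "inv_image subformula_rel snd")
  subgoal by (rule wf_inv_image[OF wf_subformula_rel])
  subgoal by (simp only: in_inv_image snd_conv) (rule subformula_relI(1), erule (1) subsetD)
  subgoal by (simp only: in_inv_image snd_conv) (rule subformula_relI(2))
  subgoal by (simp only: in_inv_image snd_conv) (rule subformula_relI(3))
  done

declare sat.simps [simp del]

definition logically_equivalent :: "'st \<Rightarrow> 'st \<Rightarrow> bool" where
  "logically_equivalent P Q \<longleftrightarrow> (\<forall>A\<in>formulas. sat P A \<longleftrightarrow> sat Q A)"

end


section \<open>Freeness of the constructors up to alpha-equivalence, and the satisfaction clauses\<close>

lemma perms_one: "1 \<in> perms srt"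
  by (simp add: perms_def)

lemma perms_times: "p \<in> perms srt \<Longrightarrow> q \<in> perms srt \<Longrightarrow> p * q \<in> perms srt"
  by (simp add: perms_def apply_times)

lemma apply_inverse_apply [simp]: "inverse p \<langle>$\<rangle> (p \<langle>$\<rangle> a) = a" "p \<langle>$\<rangle> (inverse p \<langle>$\<rangle> a) = a"
  by (simp_all add: apply_sequence)

lemma perms_inverse:
  assumes "p \<in> perms srt"
  shows "inverse p \<in> perms srt"
proof -
  have "srt (p \<langle>$\<rangle> (inverse p \<langle>$\<rangle> a)) = srt (inverse p \<langle>$\<rangle> a)" for a
    using assms unfolding perms_def by blast
  then show ?thesis by (simp add: perms_def)
qed

text \<open>The group action part of a nominal set.\<close>

definition action :: "('n \<Rightarrow> 's) \<Rightarrow> 'x set \<Rightarrow> ('n perm \<Rightarrow> 'x \<Rightarrow> 'x) \<Rightarrow> bool" where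
  "action srt X act \<longleftrightarrow>
     (\<forall>p\<in>perms srt. \<forall>x\<in>X. act p x \<in> X) \<and>
     (\<forall>x\<in>X. act 1 x = x) \<and>
     (\<forall>p\<in>perms srt. \<forall>q\<in>perms srt. \<forall>x\<in>X. act (p * q) x = act p (act q x))"

lemma action_closed: "action srt X act \<Longrightarrow> p \<in> perms srt \<Longrightarrow> x \<in> X \<Longrightarrow> act p x \<in> X"
  by (simp add: action_def)

lemma action_one: "action srt X act \<Longrightarrow> x \<in> X \<Longrightarrow> act 1 x = x"
  by (simp add: action_def)

lemma action_times: "action srt X act \<Longrightarrow> p \<in> perms srt \<Longrightarrow> q \<in> perms srt \<Longrightarrow> x \<in> X \<Longrightarrow>
    act p (act q x) = act (p * q) x"
  by (simp add: action_def)

lemma action_inverse: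
  assumes "action srt X act" "p \<in> perms srt" "x \<in> X"
  shows "act (inverse p) (act p x) = x" "act p (act (inverse p) x) = x"
  using assms by (simp_all add: action_times perms_inverse action_one)

lemma nominal_set_action: "nominal_set srt X act \<Longrightarrow> action srt X act"
  by (simp add: nominal_set_def action_def)

lemma action_set: "action srt X act \<Longrightarrow> action srt (Pow X) (set_act act)"
  unfolding action_def set_act_def
proof (intro conjI ballI; elim conjE)
  fix A assume "A \<in> Pow X" "\<forall>x\<in>X. act 1 x = x"
  then have "act 1 ` A = id ` A" by (intro image_cong) auto
  then show "act 1 ` A = A" by simp
next
  fix p q A assume "p \<in> perms srt" "q \<in> perms srt" "A \<in> Pow X"
    "\<forall>p\<in>perms srt. \<forall>q\<in>perms srt. \<forall>x\<in>X. act (p * q) x = act p (act q x)"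
  then show "act (p * q) ` A = act p ` act q ` A"
    unfolding image_image by (intro image_cong) auto
qed auto

lemma action_prod: "action srt X act \<Longrightarrow> action srt Y act' \<Longrightarrow> action srt (X \<times> Y) (prod_act act act')"
  by (auto simp: action_def prod_act_def)

lemma action_names: "action srt UNIV Perm.apply"
  by (simp add: action_def apply_times)

lemma supports_act:
  assumes act: "action srt X act" and p: "p \<in> perms srt" and x: "x \<in> X" and S: "supports srt act S x"
  shows "supports srt act (Perm.apply p ` S) (act p x)"
  unfolding supports_def
proof (intro ballI impI)
  fix q assume q: "q \<in> perms srt" and fix_q: "\<forall>a\<in>Perm.apply p ` S. q \<langle>$\<rangle> a = a"
  let ?r = "inverse p * (q * p)"
  have r: "?r \<in> perms srt" using p q by (simp add: perms_times perms_inverse)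
  have "?r \<langle>$\<rangle> a = a" if "a \<in> S" for a
    using fix_q that by (simp add: apply_times)
  with S r have "act ?r x = x" by (auto simp: supports_def)
  then have "act p (act ?r x) = act p x" by simp
  moreover have "act p (act ?r x) = act (p * ?r) x"
    by (rule action_times[OF act p r x])
  moreover have "p * ?r = q * p" by (simp add: mult.assoc[symmetric])
  ultimately show "act q (act p x) = act p x"
    by (simp add: action_times[OF act q p x])
qed

lemma supp_act:
  assumes act: "action srt X act" and p: "p \<in> perms srt" and x: "x \<in> X"
  shows "supp srt act (act p x) = Perm.apply p ` supp srt act x"
proof -
  have sub: "a \<in> supp srt act x" if "p \<in> perms srt" "x \<in> X" "p \<langle>$\<rangle> a \<in> supp srt act (act p x)" for p x a
    unfolding supp_def
  proof safe
    fix S assume "finite S" "supports srt act S x"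
    then have "p \<langle>$\<rangle> a \<in> Perm.apply p ` S"
      using that supports_act[OF act that(1,2)] by (auto simp: supp_def)
    then show "a \<in> S" by (auto simp: apply_inj)
  qed
  show ?thesis
  proof (intro set_eqI iffI)
    fix b assume "b \<in> supp srt act (act p x)"
    then have "inverse p \<langle>$\<rangle> b \<in> supp srt act x"
      using sub[OF p x, of "inverse p \<langle>$\<rangle> b"] by simp
    then show "b \<in> Perm.apply p ` supp srt act x"
      by (metis apply_inverse_apply(2) imageI)
  next
    fix b assume "b \<in> Perm.apply p ` supp srt act x"
    then obtain a where a: "a \<in> supp srt act x" "b = p \<langle>$\<rangle> a" by blast
    with sub[OF perms_inverse[OF p] action_closed[OF act p x], of "p \<langle>$\<rangle> a"]
    show "b \<in> supp srt act (act p x)"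
      by (simp add: action_inverse[OF act p x])
  qed
qed

lemma alpha_eqI:
  "p \<in> perms srt \<Longrightarrow> (\<And>a. a \<in> supp srt act X \<Longrightarrow> a \<notin> N \<Longrightarrow> p \<langle>$\<rangle> a = a) \<Longrightarrow>
   N' = Perm.apply p ` N \<Longrightarrow> X' = act p X \<Longrightarrow> alpha_eq srt act (N, X) (N', X')"
  by (auto simp: alpha_eq_def prod_act_def set_act_def)

lemma alpha_eqE:
  assumes "alpha_eq srt act (N, X) (N', X')"
  obtains p where "p \<in> perms srt" "\<forall>a\<in>supp srt act X - N. p \<langle>$\<rangle> a = a"
    "N' = Perm.apply p ` N" "X' = act p X"
  using assms by (auto simp: alpha_eq_def prod_act_def set_act_def)

lemma alpha_eq_refl: "action srt S act \<Longrightarrow> X \<in> S \<Longrightarrow> alpha_eq srt act (N, X) (N, X)"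
  by (rule alpha_eqI[OF perms_one]) (simp_all add: action_one)

lemma alpha_eq_sym:
  assumes act: "action srt S act" and X: "X \<in> S" and eq: "alpha_eq srt act (N, X) (N', X')"
  shows "alpha_eq srt act (N', X') (N, X)"
proof -
  from eq obtain p where p: "p \<in> perms srt" "\<forall>a\<in>supp srt act X - N. p \<langle>$\<rangle> a = a"
    "N' = Perm.apply p ` N" "X' = act p X" by (rule alpha_eqE)
  show ?thesis
  proof (rule alpha_eqI[OF perms_inverse[OF p(1)]])
    fix a assume "a \<in> supp srt act X'" "a \<notin> N'"
    then obtain b where "b \<in> supp srt act X" "b \<notin> N" "a = p \<langle>$\<rangle> b"
      using p(3,4) by (auto simp: supp_act[OF act p(1) X])
    with p(2) show "inverse p \<langle>$\<rangle> a = a" by (metis Diff_iff apply_inverse_apply(1))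
  qed (simp_all add: p(3,4) image_image action_inverse[OF act p(1) X])
qed

lemma alpha_eq_trans:
  assumes act: "action srt S act" and X: "X \<in> S"
    and eq: "alpha_eq srt act (N, X) (N', X')" "alpha_eq srt act (N', X') (N'', X'')"
  shows "alpha_eq srt act (N, X) (N'', X'')"
proof -
  from eq(1) obtain p where p: "p \<in> perms srt" "\<forall>a\<in>supp srt act X - N. p \<langle>$\<rangle> a = a"
    "N' = Perm.apply p ` N" "X' = act p X" by (rule alpha_eqE)
  from eq(2) obtain q where q: "q \<in> perms srt" "\<forall>a\<in>supp srt act X' - N'. q \<langle>$\<rangle> a = a"
    "N'' = Perm.apply q ` N'" "X'' = act q X'" by (rule alpha_eqE)
  show ?thesis
  proof (rule alpha_eqI[OF perms_times[OF q(1) p(1)]])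
    fix a assume a: "a \<in> supp srt act X" "a \<notin> N"
    then have "p \<langle>$\<rangle> a \<in> supp srt act X'" "p \<langle>$\<rangle> a \<notin> N'"
      using p(3,4) by (auto simp: supp_act[OF act p(1) X] apply_inj)
    with a p(2) q(2) show "(q * p) \<langle>$\<rangle> a = a"
      by (simp add: apply_times)
  qed (simp_all add: p(3,4) q(3,4) image_image apply_times action_times[OF act q(1) p(1) X])
qed

lemma alpha_eq_act:
  assumes act: "action srt S act" and X: "X \<in> S" and p: "p \<in> perms srt"
    and eq: "alpha_eq srt act (N, X) (N', X')"
  shows "alpha_eq srt act (Perm.apply p ` N, act p X) (Perm.apply p ` N', act p X')"
proof -
  from eq obtain q where q: "q \<in> perms srt" "\<forall>a\<in>supp srt act X - N. q \<langle>$\<rangle> a = a"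
    "N' = Perm.apply q ` N" "X' = act q X" by (rule alpha_eqE)
  let ?r = "p * (q * inverse p)"
  have r: "?r \<in> perms srt" using p q by (simp add: perms_times perms_inverse)
  show ?thesis
  proof (rule alpha_eqI[OF r])
    fix a assume "a \<in> supp srt act (act p X)" "a \<notin> Perm.apply p ` N"
    then obtain b where "b \<in> supp srt act X" "b \<notin> N" "a = p \<langle>$\<rangle> b"
      by (auto simp: supp_act[OF act p X])
    then show "?r \<langle>$\<rangle> a = a" by (simp add: apply_times q(2))
  next
    show "Perm.apply p ` N' = Perm.apply ?r ` (Perm.apply p ` N)"
      by (simp add: q(3) image_image apply_times)
    have "act ?r (act p X) = act (?r * p) X" by (rule action_times[OF act r p X])
    also have "?r * p = p * q" by (simp add: mult.assoc)
    finally show "act p X' = act ?r (act p X)"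
      by (simp add: q(4) action_times[OF act p q(1) X])
  qed
qed

context nominal_logic
begin

abbreviation raw_act :: "'n perm \<Rightarrow> ('k, 'p, 'a) raw \<Rightarrow> ('k, 'p, 'a) raw" where
  "raw_act p \<equiv> map_raw (actP p) (actA p)"

definition RAW :: "('k, 'p, 'a) raw set" where
  "RAW = {r. set1_raw r \<subseteq> PRED \<and> set2_raw r \<subseteq> ACT}"

lemma action_PRED: "action srt PRED actP" and action_ACT: "action srt ACT actA"
  using nominal_PRED nominal_ACT by (simp_all add: nominal_set_action)

lemma action_RAW: "action srt RAW raw_act"
  unfolding action_def
proof (intro conjI ballI)
  fix p r assume "p \<in> perms srt" "r \<in> RAW"
  then show "raw_act p r \<in> RAW"
    using action_PRED action_ACT by (auto simp: RAW_def raw.set_map action_def)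
next
  fix r assume "r \<in> RAW"
  then have "raw_act 1 r = map_raw id id r"
    by (intro raw.map_cong) (auto simp: RAW_def action_one[OF action_PRED] action_one[OF action_ACT])
  then show "raw_act 1 r = r" by (simp add: raw.map_id)
next
  fix p q r assume "p \<in> perms srt" "q \<in> perms srt" "r \<in> RAW"
  then show "raw_act (p * q) r = raw_act p (raw_act q r)"
    unfolding raw.map_comp
    by (intro raw.map_cong) (auto simp: RAW_def action_times[OF action_PRED] action_times[OF action_ACT])
qed

lemma action_form: "action srt (Pow RAW) form_act"
  unfolding form_act_def by (rule action_set[OF action_RAW])

lemma action_act_form: "action srt (ACT \<times> Pow RAW) (prod_act actA form_act)"
  by (rule action_prod[OF action_ACT action_form])

lemma in_Act_iff:
  "r \<in> Act \<alpha> A \<longleftrightarrow> (\<exists>N \<beta> B s. r = RAct \<beta> s \<and> s \<in> B \<and>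
     alpha_eq srt (prod_act actA form_act) (bn \<alpha>, \<alpha>, A) (N, \<beta>, B))"
  by (auto simp: Act_def abstraction_def)

lemma alpha_eq_ActE:
  assumes "alpha_eq srt (prod_act actA form_act) (bn \<alpha>, \<alpha>, A) (N, \<beta>, B)" "\<alpha> \<in> ACT"
  obtains p where "p \<in> perms srt" "\<beta> = actA p \<alpha>" "B = form_act p A" "N = bn \<beta>"
  using assms by (auto elim!: alpha_eqE simp: prod_act_def bn_eqvt set_act_def)

lemma RConj_RAW: "RConj F \<in> RAW \<longleftrightarrow> ran F \<subseteq> RAW"
proof -
  have "set1_raw (RConj F) = (\<Union>s\<in>ran F. set1_raw s)" "set2_raw (RConj F) = (\<Union>s\<in>ran F. set2_raw s)"
    by (fastforce simp: ran_def intro: range_eqI[OF sym])+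
  then show ?thesis unfolding RAW_def by blast
qed

lemma Conj_RAW: "\<Union>\<A> \<subseteq> RAW \<Longrightarrow> Conj \<A> \<subseteq> RAW"
  by (auto simp: Conj_def RConj_RAW)

lemma Act_RAW:
  assumes "\<alpha> \<in> ACT" "A \<subseteq> RAW"
  shows "Act \<alpha> A \<subseteq> RAW"
proof
  fix r assume "r \<in> Act \<alpha> A"
  then obtain N \<beta> B s where r: "r = RAct \<beta> s" "s \<in> B"
    and eq: "alpha_eq srt (prod_act actA form_act) (bn \<alpha>, \<alpha>, A) (N, \<beta>, B)"
    by (auto simp: in_Act_iff)
  from eq assms(1) obtain p where p: "p \<in> perms srt" "\<beta> = actA p \<alpha>" "B = form_act p A"
    by (rule alpha_eq_ActE)
  then have "\<beta> \<in> ACT" "B \<in> Pow RAW"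
    using assms action_closed[OF action_ACT] action_closed[OF action_form] by simp_all
  with r show "r \<in> RAW" by (auto simp: RAW_def)
qed

lemma formulas_RAW: "A \<in> formulas \<Longrightarrow> A \<subseteq> RAW"
proof (induction rule: formulas.induct)
  case (Conj \<A>)
  then show ?case by (intro Conj_RAW) blast
next
  case (Act \<alpha> A)
  then show ?case by (intro Act_RAW)
qed (auto simp: Neg_def Pred_def RAW_def subset_iff)

lemma form_act_eqI:
  assumes p: "p \<in> perms srt" and sub: "C \<subseteq> RAW" "D \<subseteq> RAW"
    and le: "form_act p C \<subseteq> D" "form_act (inverse p) D \<subseteq> C"
  shows "form_act p C = D"
proof
  have "form_act p (form_act (inverse p) D) \<subseteq> form_act p C"
    using le(2) by (auto simp: form_act_def set_act_def)
  then show "D \<subseteq> form_act p C"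
    using action_inverse(2)[OF action_form p, of D] sub(2) by simp
qed (rule le)

lemma form_act_Conj_le: "form_act p (Conj \<A>) \<subseteq> Conj (form_act p ` \<A>)"
proof -
  have "raw_act p (RConj F) \<in> Conj (form_act p ` \<A>)"
    if F: "ran F \<subseteq> \<Union>\<A>" "\<forall>A\<in>\<A>. ran F \<inter> A \<noteq> {}" for F
  proof -
    let ?G = "map_option (raw_act p) \<circ> F"
    have ran: "ran ?G = raw_act p ` ran F"
      by (auto simp: ran_def)
    have "ran ?G \<subseteq> \<Union>(form_act p ` \<A>)"
      using F(1) unfolding ran form_act_def set_act_def by blast
    moreover have "ran ?G \<inter> form_act p A \<noteq> {}" if "A \<in> \<A>" for A
      using F(2) that unfolding ran form_act_def set_act_def by blast
    ultimately show ?thesis by (simp add: Conj_def)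
  qed
  then show ?thesis by (auto simp: form_act_def set_act_def Conj_def)
qed

lemma form_act_Conj:
  assumes p: "p \<in> perms srt" and \<A>: "\<Union>\<A> \<subseteq> RAW"
  shows "form_act p (Conj \<A>) = Conj (form_act p ` \<A>)"
proof (rule form_act_eqI[OF p])
  have "\<Union>(form_act p ` \<A>) \<subseteq> RAW"
    using \<A> action_closed[OF action_form p] by blast
  then show "Conj (form_act p ` \<A>) \<subseteq> RAW" by (rule Conj_RAW)
  have "form_act (inverse p) ` form_act p ` \<A> = id ` \<A>"
    unfolding image_image using \<A>
    by (intro image_cong) (auto simp: action_inverse(1)[OF action_form p] Sup_le_iff)
  then show "form_act (inverse p) (Conj (form_act p ` \<A>)) \<subseteq> Conj \<A>"
    using form_act_Conj_le[of "inverse p" "form_act p ` \<A>"] by simp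
qed (use \<A> in \<open>simp_all add: Conj_RAW form_act_Conj_le\<close>)

lemma form_act_Neg: "form_act p (Neg A) = Neg (form_act p A)"
  by (simp add: form_act_def set_act_def Neg_def image_image)

lemma form_act_Pred: "form_act p (Pred \<phi>) = Pred (actP p \<phi>)"
  by (simp add: form_act_def set_act_def Pred_def)

lemma form_act_Act_le:
  assumes p: "p \<in> perms srt" and \<alpha>: "\<alpha> \<in> ACT" and A: "A \<subseteq> RAW"
  shows "form_act p (Act \<alpha> A) \<subseteq> Act (actA p \<alpha>) (form_act p A)"
proof
  fix r' assume "r' \<in> form_act p (Act \<alpha> A)"
  then obtain N \<beta> B s where r: "r' = RAct (actA p \<beta>) (raw_act p s)" "s \<in> B"
    and eq: "alpha_eq srt (prod_act actA form_act) (bn \<alpha>, \<alpha>, A) (N, \<beta>, B)"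
    by (auto simp: form_act_def set_act_def in_Act_iff)
  have "alpha_eq srt (prod_act actA form_act) (bn (actA p \<alpha>), actA p \<alpha>, form_act p A)
      (Perm.apply p ` N, actA p \<beta>, form_act p B)"
    using alpha_eq_act[OF action_act_form _ p eq] \<alpha> A
    by (simp add: prod_act_def bn_eqvt[OF p \<alpha>] set_act_def)
  moreover have "raw_act p s \<in> form_act p B"
    using r(2) by (simp add: form_act_def set_act_def)
  ultimately show "r' \<in> Act (actA p \<alpha>) (form_act p A)"
    unfolding in_Act_iff r(1) by blast
qed

lemma form_act_Act:
  assumes p: "p \<in> perms srt" and \<alpha>: "\<alpha> \<in> ACT" and A: "A \<subseteq> RAW"
  shows "form_act p (Act \<alpha> A) = Act (actA p \<alpha>) (form_act p A)"
proof (rule form_act_eqI[OF p Act_RAW[OF \<alpha> A]])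
  have pA: "actA p \<alpha> \<in> ACT" "form_act p A \<subseteq> RAW"
    using \<alpha> A action_closed[OF action_ACT p] action_closed[OF action_form p] by auto
  then show "Act (actA p \<alpha>) (form_act p A) \<subseteq> RAW" by (rule Act_RAW)
  show "form_act (inverse p) (Act (actA p \<alpha>) (form_act p A)) \<subseteq> Act \<alpha> A"
    using form_act_Act_le[OF perms_inverse[OF p] pA] A
    by (simp add: action_inverse[OF action_form p] action_inverse[OF action_ACT p \<alpha>])
qed (rule form_act_Act_le[OF assms])

lemma formulas_act: "A \<in> formulas \<Longrightarrow> p \<in> perms srt \<Longrightarrow> form_act p A \<in> formulas"
proof (induction rule: formulas.induct)
  case (Conj \<A>)
  have \<A>: "\<Union>\<A> \<subseteq> RAW" using Conj(1) formulas_RAW by blast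
  have "|form_act p ` \<A>| <o \<kappa>"
    using Conj(2) card_of_image ordLeq_ordLess_trans by blast
  moreover have "finitely_supported srt (set_act form_act) (form_act p ` \<A>)"
  proof -
    from Conj(3) obtain S where S: "finite S" "supports srt (set_act form_act) S \<A>"
      by (auto simp: finitely_supported_def)
    have "\<A> \<in> Pow (Pow RAW)" using \<A> by blast
    from supports_act[OF action_set[OF action_form] Conj(4) this S(2)] S(1)
    show ?thesis by (auto simp: finitely_supported_def set_act_def)
  qed
  ultimately show ?case
    using Conj(1,4) by (auto simp: form_act_Conj[OF Conj(4) \<A>] intro!: formulas.Conj)
next
  case (Neg A)
  then show ?case by (simp add: form_act_Neg formulas.Neg)
next
  case (Pred \<phi>)
  then show ?case by (simp add: form_act_Pred formulas.Pred action_closed[OF action_PRED])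
next
  case (Act \<alpha> A)
  then show ?case
    by (simp add: form_act_Act formulas_RAW formulas.Act action_closed[OF action_ACT])
qed

lemma Act_eqI:
  assumes "\<alpha> \<in> ACT" "A \<subseteq> RAW" "\<beta> \<in> ACT" "B \<subseteq> RAW"
    and eq: "alpha_eq srt (prod_act actA form_act) (bn \<alpha>, \<alpha>, A) (bn \<beta>, \<beta>, B)"
  shows "Act \<alpha> A = Act \<beta> B"
proof -
  have mem: "(\<alpha>, A) \<in> ACT \<times> Pow RAW" "(\<beta>, B) \<in> ACT \<times> Pow RAW" using assms by auto
  note eq' = alpha_eq_sym[OF action_act_form mem(1) eq]
  show ?thesis
    unfolding set_eq_iff in_Act_iff
    using alpha_eq_trans[OF action_act_form mem(1) eq] alpha_eq_trans[OF action_act_form mem(2) eq']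
    by blast
qed

lemma representatives_subset:
  assumes "R \<subseteq> \<Union>\<B>" "\<forall>A\<in>\<A>. R \<inter> A \<noteq> {}"
    and "\<And>A B s. A \<in> \<A> \<Longrightarrow> B \<in> \<B> \<Longrightarrow> s \<in> A \<Longrightarrow> s \<in> B \<Longrightarrow> A = B"
  shows "\<A> \<subseteq> \<B>"
proof
  fix A assume A: "A \<in> \<A>"
  with assms(2) obtain s where "s \<in> R" "s \<in> A" by blast
  moreover with assms(1) obtain B where "B \<in> \<B>" "s \<in> B" by blast
  ultimately show "A \<in> \<B>" using assms(3) A by metis
qed

text \<open>Distinct formulas are disjoint sets of trees, so a tree denotes at most one formula.\<close>

lemma formulas_disjoint: "A \<in> formulas \<Longrightarrow> B \<in> formulas \<Longrightarrow> r \<in> A \<Longrightarrow> r \<in> B \<Longrightarrow> A = B"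
proof (induction arbitrary: B r rule: formulas.induct)
  case (Conj \<A>)
  from Conj.prems(2) obtain F where F: "r = RConj F" "ran F \<subseteq> \<Union>\<A>" "\<forall>A\<in>\<A>. ran F \<inter> A \<noteq> {}"
    by (auto simp: Conj_def)
  from Conj.prems(1,3) obtain \<B> where \<B>: "B = Conj \<B>" "\<B> \<subseteq> formulas"
    unfolding F(1) by cases (auto simp: Neg_def Pred_def in_Act_iff)
  with Conj.prems(3) F(1) have G: "ran F \<subseteq> \<Union>\<B>" "\<forall>A\<in>\<B>. ran F \<inter> A \<noteq> {}"
    by (auto simp: Conj_def)
  have "A = B" if "A \<in> \<A>" "B \<in> \<B>" "s \<in> A" "s \<in> B" for A B s
    using Conj(1) that \<B>(2) by blast
  then have "\<A> \<subseteq> \<B>" "\<B> \<subseteq> \<A>"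
    using representatives_subset[OF G(1) F(3)] representatives_subset[OF F(2) G(2)] by metis+
  then show ?case using \<B>(1) by (simp add: subset_antisym)
next
  case (Neg A)
  from Neg.prems(2) obtain s where s: "r = RNeg s" "s \<in> A" by (auto simp: Neg_def)
  from Neg.prems(1,3) obtain B' where "B = Neg B'" "B' \<in> formulas" "s \<in> B'"
    unfolding s(1) by cases (auto simp: Neg_def Pred_def in_Act_iff Conj_def)
  with Neg.IH s show ?case by blast
next
  case (Pred \<phi>)
  then have "RPred \<phi> \<in> B" by (simp add: Pred_def)
  with Pred.prems(1) show ?case
    by cases (auto simp: Neg_def Pred_def in_Act_iff Conj_def)
next
  case (Act \<alpha> A)
  from Act.prems(2) obtain N \<beta> A' s where r: "r = RAct \<beta> s" "s \<in> A'"
    and eq: "alpha_eq srt (prod_act actA form_act) (bn \<alpha>, \<alpha>, A) (N, \<beta>, A')"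
    by (auto simp: in_Act_iff)
  from Act.prems(1,3) obtain \<gamma> C where B: "B = Act \<gamma> C" "\<gamma> \<in> ACT" "C \<in> formulas" "r \<in> Act \<gamma> C"
    unfolding r(1) by cases (auto simp: Neg_def Pred_def Conj_def)
  from B(4) r(1) obtain N' C' where C': "s \<in> C'"
    and eq': "alpha_eq srt (prod_act actA form_act) (bn \<gamma>, \<gamma>, C) (N', \<beta>, C')"
    by (auto simp: in_Act_iff)
  from eq Act(1) obtain p where p: "p \<in> perms srt" "\<beta> = actA p \<alpha>" "A' = form_act p A" "N = bn \<beta>"
    by (rule alpha_eq_ActE)
  from eq' B(2) obtain q where q: "q \<in> perms srt" "\<beta> = actA q \<gamma>" "C' = form_act q C" "N' = bn \<beta>"
    by (rule alpha_eq_ActE)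
  have A'f: "A' \<in> formulas" and C'f: "C' \<in> formulas"
    using p q Act(2) B(3) formulas_act by auto
  have inv: "inverse p \<in> perms srt" by (rule perms_inverse[OF p(1)])
  have A_eq: "form_act (inverse p) A' = A"
    using p(1,3) formulas_RAW[OF Act(2)] by (simp add: action_inverse[OF action_form])
  have "raw_act (inverse p) s \<in> form_act (inverse p) A'" "raw_act (inverse p) s \<in> form_act (inverse p) C'"
    using r(2) C' by (auto simp: form_act_def set_act_def)
  then have "A = form_act (inverse p) C'"
    using Act.IH[OF formulas_act[OF C'f inv]] A_eq by simp
  then have "A' = C'"
    using p(1,3) formulas_RAW[OF C'f] by (simp add: action_inverse[OF action_form])
  have mem: "(\<alpha>, A) \<in> ACT \<times> Pow RAW" "(\<gamma>, C) \<in> ACT \<times> Pow RAW"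
    using Act(1,2) B(2,3) formulas_RAW by auto
  have "alpha_eq srt (prod_act actA form_act) (bn \<beta>, \<beta>, A') (bn \<gamma>, \<gamma>, C)"
    using alpha_eq_sym[OF action_act_form mem(2) eq'] by (simp add: \<open>A' = C'\<close> q(4))
  then have "alpha_eq srt (prod_act actA form_act) (bn \<alpha>, \<alpha>, A) (bn \<gamma>, \<gamma>, C)"
    using alpha_eq_trans[OF action_act_form mem(1) eq] p(4) by simp
  then show ?case
    unfolding B(1) using mem by (intro Act_eqI) auto
qed

theorem Conj_eq_iff:
  assumes "\<A> \<subseteq> formulas" "\<B> \<subseteq> formulas" "Conj \<A> \<in> formulas"
  shows "Conj \<A> = Conj \<B> \<longleftrightarrow> \<A> = \<B>"
proof
  assume eq: "Conj \<A> = Conj \<B>"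
  obtain r where "r \<in> Conj \<A>" using formulas_nonempty[OF assms(3)] by blast
  then obtain F :: "'k \<Rightarrow> ('k, 'p, 'a) raw option"
    where F1: "r = RConj F" "ran F \<subseteq> \<Union>\<A>" "\<forall>A\<in>\<A>. ran F \<inter> A \<noteq> {}"
    by (auto simp: Conj_def)
  have "r \<in> Conj \<B>" using \<open>r \<in> Conj \<A>\<close> eq by simp
  with F1(1) have F2: "ran F \<subseteq> \<Union>\<B>" "\<forall>B\<in>\<B>. ran F \<inter> B \<noteq> {}"
    by (auto simp: Conj_def)
  have "A = B" if "A \<in> \<A>" "B \<in> \<B>" "s \<in> A" "s \<in> B" for A B s
    using that assms formulas_disjoint by blast
  then have "\<A> \<subseteq> \<B>" "\<B> \<subseteq> \<A>"
    using representatives_subset[OF F2(1) F1(3)] representatives_subset[OF F1(2) F2(2)] by metis+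
  then show "\<A> = \<B>" by blast
qed simp

theorem Neg_eq_iff: "Neg A = Neg B \<longleftrightarrow> A = B"
  unfolding Neg_def by (rule inj_image_eq_iff) (simp add: inj_def)

theorem Pred_eq_iff: "Pred \<phi> = Pred \<psi> \<longleftrightarrow> \<phi> = \<psi>"
  by (simp add: Pred_def)

theorem Act_eq_iff:
  assumes "\<alpha> \<in> ACT" "A \<in> formulas" "\<beta> \<in> ACT" "B \<in> formulas"
  shows "Act \<alpha> A = Act \<beta> B \<longleftrightarrow>
    alpha_eq srt (prod_act actA form_act) (bn \<alpha>, \<alpha>, A) (bn \<beta>, \<beta>, B)"
proof
  assume eq: "Act \<alpha> A = Act \<beta> B"
  obtain s where s: "s \<in> B" using formulas_nonempty[OF assms(4)] by blast
  have memB: "(\<beta>, B) \<in> ACT \<times> Pow RAW" using assms formulas_RAW by auto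
  then have "RAct \<beta> s \<in> Act \<beta> B"
    unfolding in_Act_iff using s alpha_eq_refl[OF action_act_form memB] by blast
  with eq have "RAct \<beta> s \<in> Act \<alpha> A" by simp
  then obtain N B' where B': "s \<in> B'" "alpha_eq srt (prod_act actA form_act) (bn \<alpha>, \<alpha>, A) (N, \<beta>, B')"
    by (auto simp: in_Act_iff)
  from B'(2) assms(1) obtain p where p: "p \<in> perms srt" "B' = form_act p A" "N = bn \<beta>"
    by (rule alpha_eq_ActE) 
  then have "B' = B"
    using formulas_disjoint[OF formulas_act[OF assms(2) p(1)] assms(4)] s B'(1) by simp
  with B'(2) p(3) show "alpha_eq srt (prod_act actA form_act) (bn \<alpha>, \<alpha>, A) (bn \<beta>, \<beta>, B)" by simp
qed (rule Act_eqI[OF assms(1) formulas_RAW[OF assms(2)] assms(3) formulas_RAW[OF assms(4)]])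

lemma constructors_distinct:
  assumes "X \<in> formulas"
  shows "X = Conj \<A> \<Longrightarrow> X \<noteq> Neg B" "X = Conj \<A> \<Longrightarrow> X \<noteq> Pred \<phi>" "X = Conj \<A> \<Longrightarrow> X \<noteq> Act \<alpha> C"
    "X = Neg B \<Longrightarrow> X \<noteq> Pred \<phi>" "X = Neg B \<Longrightarrow> X \<noteq> Act \<alpha> C" "X = Pred \<phi> \<Longrightarrow> X \<noteq> Act \<alpha> C"
proof -
  obtain r where r: "r \<in> X" using formulas_nonempty[OF assms] by blast
  have c: "r \<in> Conj \<A> \<Longrightarrow> \<exists>F. r = RConj F" "r \<in> Neg B \<Longrightarrow> \<exists>s. r = RNeg s"
    "r \<in> Pred \<phi> \<Longrightarrow> r = RPred \<phi>" "r \<in> Act \<alpha> C \<Longrightarrow> \<exists>\<beta> s. r = RAct \<beta> s"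
    by (auto simp: Conj_def Neg_def Pred_def in_Act_iff)
  show "X = Conj \<A> \<Longrightarrow> X \<noteq> Neg B" "X = Conj \<A> \<Longrightarrow> X \<noteq> Pred \<phi>" "X = Conj \<A> \<Longrightarrow> X \<noteq> Act \<alpha> C"
    "X = Neg B \<Longrightarrow> X \<noteq> Pred \<phi>" "X = Neg B \<Longrightarrow> X \<noteq> Act \<alpha> C" "X = Pred \<phi> \<Longrightarrow> X \<noteq> Act \<alpha> C"
    using r c raw.distinct by metis+
qed

theorem sat_Conj:
  assumes "Conj \<A> \<in> formulas" "\<A> \<subseteq> formulas"
  shows "sat P (Conj \<A>) \<longleftrightarrow> (\<forall>A\<in>\<A>. sat P A)"
proof -
  have "Conj \<A> \<noteq> Neg A" "Conj \<A> \<noteq> Pred \<phi>" "Conj \<A> \<noteq> Act \<alpha> A" for A \<phi> \<alpha>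
    using constructors_distinct[OF assms(1)] by metis+
  moreover have "(\<exists>\<B>. Conj \<A> = Conj \<B> \<and> \<B> \<subseteq> formulas \<and> (\<forall>A\<in>\<B>. sat P A)) \<longleftrightarrow> (\<forall>A\<in>\<A>. sat P A)"
    using Conj_eq_iff[OF assms(2) _ assms(1)] assms(2) by blast
  ultimately show ?thesis by (subst sat.simps) simp
qed

theorem sat_Neg:
  assumes "A \<in> formulas"
  shows "sat P (Neg A) \<longleftrightarrow> \<not> sat P A"
proof -
  have "Neg A \<noteq> Conj \<A>" "Neg A \<noteq> Pred \<phi>" "Neg A \<noteq> Act \<alpha> B" for \<A> B \<phi> \<alpha>
    using constructors_distinct[OF formulas.Neg[OF assms]] by metis+
  then show ?thesis using assms by (subst sat.simps) (auto simp: Neg_eq_iff)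
qed

theorem sat_Pred:
  assumes "\<phi> \<in> PRED"
  shows "sat P (Pred \<phi>) \<longleftrightarrow> (P, \<phi>) \<in> entails"
proof -
  have "Pred \<phi> \<noteq> Conj \<A>" "Pred \<phi> \<noteq> Neg A" "Pred \<phi> \<noteq> Act \<alpha> A" for \<A> A \<alpha>
    using constructors_distinct[OF formulas.Pred[OF assms]] by metis+
  then show ?thesis using assms by (subst sat.simps) (auto simp: Pred_eq_iff)
qed

theorem sat_Act:
  assumes "\<alpha> \<in> ACT" "A \<in> formulas"
  shows "sat P (Act \<alpha> A) \<longleftrightarrow> (\<exists>\<beta>\<in>ACT. \<exists>B\<in>formulas.
    alpha_eq srt (prod_act actA form_act) (bn \<alpha>, \<alpha>, A) (bn \<beta>, \<beta>, B) \<and>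
    fresh (bn \<beta>) P \<and> (\<exists>P'. step P \<beta> P' \<and> sat P' B))"
proof -
  have "Act \<alpha> A \<noteq> Conj \<A>" "Act \<alpha> A \<noteq> Neg B" "Act \<alpha> A \<noteq> Pred \<phi>" for \<A> B \<phi>
    using constructors_distinct[OF formulas.Act[OF assms]] by metis+
  moreover have "Act \<alpha> A = Act \<beta> B \<longleftrightarrow>
      alpha_eq srt (prod_act actA form_act) (bn \<alpha>, \<alpha>, A) (bn \<beta>, \<beta>, B)"
    if "\<beta> \<in> ACT" "B \<in> formulas" for \<beta> B
    using Act_eq_iff[OF assms that] .
  ultimately show ?thesis
    by (subst sat.simps) (simp add: Bex_def conj_ac cong: conj_cong)
qed

end
end

theory Submission
  imports Defs "HOL-Library.Countable_Set_Type"
begin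

text \<open>
  Logical equivalence is itself a bisimulation. Suppose that \<open>P\<close> and \<open>Q\<close> are equivalent,
  \<open>P \<rightarrow>\<^sup>\<alpha> P'\<close> with \<open>bn \<alpha>\<close> fresh for \<open>Q\<close>, and no \<open>\<alpha>\<close>-derivative \<open>Q'\<close> of \<open>Q\<close> is equivalent to \<open>P'\<close>.
  Each such \<open>Q'\<close> is told apart from \<open>P'\<close> by a formula \<open>B\<close> that holds at \<open>P'\<close>; conjoining the countably
  many \<open>p \<bullet> B\<close> with \<open>p\<close> fixing \<open>supp P'\<close> makes it supported by \<open>supp P'\<close>. Having this common finite
  support, the distinguishing formulas have a conjunction \<open>A\<close>. Then \<open>P\<close> satisfies \<open>\<langle>\<alpha>\<rangle>A\<close>, so \<open>Q\<close> does.
  A permutation that takes a representative witnessing this back to \<open>(\<alpha>, A)\<close> can be chosen to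
  fix \<open>supp Q\<close>, and it yields an \<open>\<alpha>\<close>-derivative of \<open>Q\<close> satisfying \<open>A\<close>, a contradiction.
\<close>

section \<open>Permutations and supports\<close>

lemma perms_swap: "srt a = srt b \<Longrightarrow> Perm.swap a b \<in> perms srt"
  by (simp add: perms_def swap.rep_eq Transposition.transpose_def)

text \<open>By induction on \<open>D\<close>: a permutation \<open>p\<close> correct on
  \<open>D\<close> is corrected at a new name \<open>a\<close> by the swap of \<open>p a\<close> and
  \<open>f a\<close>. Their sorts agree, and the swap leaves each earlier value alone, since by
  injectivity it differs from both.\<close>

lemma extend_to_perm:
  assumes "finite D" "inj_on f D" "\<And>a. a \<in> D \<Longrightarrow> srt (f a) = srt a"
  obtains p where "p \<in> perms srt" "\<And>a. a \<in> D \<Longrightarrow> p \<langle>$\<rangle> a = f a"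
proof -
  have "\<exists>p\<in>perms srt. \<forall>a\<in>D. p \<langle>$\<rangle> a = f a"
    using assms
  proof (induction D)
    case empty
    show ?case using perms_one by blast
  next
    case (insert a D)
    then obtain p where p: "p \<in> perms srt" "\<forall>b\<in>D. p \<langle>$\<rangle> b = f b" by auto
    let ?q = "Perm.swap (p \<langle>$\<rangle> a) (f a) * p"
    have "?q \<in> perms srt"
      using p(1) insert.prems(2) by (intro perms_times perms_swap) (auto simp: perms_def)
    moreover have "?q \<langle>$\<rangle> b = f b" if "b \<in> D" for b
    proof -
      have "p \<langle>$\<rangle> b \<noteq> p \<langle>$\<rangle> a" using that insert.hyps by (auto simp: apply_inj)
      moreover have "f b \<noteq> f a"
        using that insert.hyps(2) insert.prems(1) by (metis inj_onD insertCI)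
      ultimately show ?thesis using p(2) that by (simp add: apply_times apply_swap_eq_iff)
    qed
    ultimately show ?case
      by (intro bexI[of _ ?q]) (auto simp: apply_times)
  qed
  then show thesis using that by blast
qed

text \<open>The two conditions on \<open>p\<close> say that \<open>p\<close> on \<open>S\<close> and
  the identity on \<open>T\<close> agree on the overlap and have no clash of values, so together
  they form an injection on \<open>S \<union> T\<close>. The resulting \<open>q\<close> acts like
  \<open>p\<close> on anything supported by \<open>S\<close> and fixes anything supported by
  \<open>T\<close>.\<close>

lemma perm_fixing:
  assumes p: "p \<in> perms srt" and fin: "finite S" "finite T"
    and fix_p: "\<And>a. a \<in> S \<inter> T \<Longrightarrow> p \<langle>$\<rangle> a = a" "\<And>a. a \<in> S \<Longrightarrow> p \<langle>$\<rangle> a \<in> T \<Longrightarrow> p \<langle>$\<rangle> a = a"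
  obtains q where "q \<in> perms srt" "\<And>a. a \<in> S \<Longrightarrow> q \<langle>$\<rangle> a = p \<langle>$\<rangle> a" "\<And>a. a \<in> T \<Longrightarrow> q \<langle>$\<rangle> a = a"
proof -
  let ?f = "\<lambda>a. if a \<in> S then p \<langle>$\<rangle> a else a"
  have inj: "inj_on ?f (S \<union> T)"
  proof (rule inj_onI)
    fix a b assume ab: "a \<in> S \<union> T" "b \<in> S \<union> T" "?f a = ?f b"
    consider "a \<in> S" "b \<in> S" | "a \<in> S" "b \<notin> S" | "a \<notin> S" "b \<in> S" | "a \<notin> S" "b \<notin> S" by blast
    then show "a = b"
    proof cases
      case 1
      then show ?thesis using ab(3) by (simp add: apply_inj)
    next
      case 2
      then have "p \<langle>$\<rangle> a = b" "b \<in> T" using ab by auto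
      then show ?thesis using fix_p(2)[OF 2(1)] by simp
    next
      case 3
      then have "p \<langle>$\<rangle> b = a" "a \<in> T" using ab by auto
      then show ?thesis using fix_p(2)[OF 3(2)] by simp
    next
      case 4
      then show ?thesis using ab(3) by simp
    qed
  qed
  obtain q where q: "q \<in> perms srt" "\<And>a. a \<in> S \<union> T \<Longrightarrow> q \<langle>$\<rangle> a = ?f a"
  proof (rule extend_to_perm[OF _ inj])
    show "finite (S \<union> T)" using fin by simp
    show "srt (?f a) = srt a" for a using p by (simp add: perms_def)
  qed blast
  show thesis
    by (rule that[OF q(1)]) (use q(2) fix_p(1) in auto)
qed

lemma fresh_injection:
  assumes sorts: "\<And>a. infinite {b. srt b = srt a}" and "finite N" "finite V"
  obtains g where "inj_on g N" "\<And>a. a \<in> N \<Longrightarrow> srt (g a) = srt a" "\<And>a. a \<in> N \<Longrightarrow> g a \<notin> V"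
proof -
  have "\<exists>g. inj_on g N \<and> (\<forall>a\<in>N. srt (g a) = srt a \<and> g a \<notin> V)"
    using assms(2)
  proof (induction N)
    case (insert a N)
    then obtain g where g: "inj_on g N" "\<forall>a\<in>N. srt (g a) = srt a \<and> g a \<notin> V" by blast
    have "infinite ({b. srt b = srt a} - (V \<union> g ` N))"
      using sorts insert.hyps(1) assms(3) by (intro Diff_infinite_finite) auto
    then obtain b where "b \<in> {b. srt b = srt a} - (V \<union> g ` N)"
      by (metis finite.emptyI ex_in_conv)
    with g insert.hyps(2) show ?case
      by (intro exI[of _ "g(a := b)"]) (auto simp: inj_on_def)
  qed simp
  then show thesis using that by blast
qed

text \<open>The values of \<open>g\<close> on \<open>N\<close> avoid \<open>F\<close>, so
  \<open>g\<close> on \<open>N\<close> glued with the identity on \<open>F - N\<close> is still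
  injective and extends to a permutation.\<close>

lemma fresh_renaming:
  assumes sorts: "\<And>a. infinite {b. srt b = srt a}" and "finite N" "finite F" "finite V"
  obtains p where "p \<in> perms srt" "\<And>a. a \<in> F - N \<Longrightarrow> p \<langle>$\<rangle> a = a" "\<And>a. a \<in> N \<Longrightarrow> p \<langle>$\<rangle> a \<notin> V"
proof -
  obtain g where g: "inj_on g N" "\<And>a. a \<in> N \<Longrightarrow> srt (g a) = srt a" "\<And>a. a \<in> N \<Longrightarrow> g a \<notin> F \<union> V"
    using fresh_injection[OF sorts assms(2), of "F \<union> V"] assms(3,4) by blast
  let ?f = "\<lambda>a. if a \<in> N then g a else a"
  have "inj_on ?f (F \<union> N)" using g(1,3) by (auto simp: inj_on_def)
  moreover have "srt (?f a) = srt a" for a using g(2) by simp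
  ultimately obtain p where "p \<in> perms srt" "\<And>a. a \<in> F \<union> N \<Longrightarrow> p \<langle>$\<rangle> a = ?f a"
    using extend_to_perm[of "F \<union> N" ?f srt] assms(2,3) by blast
  then show thesis using that[of p] g(3) by auto
qed

section \<open>Least finite supports\<close>

lemma supports_act_cong:
  assumes act: "action srt X act" and x: "x \<in> X" and S: "supports srt act S x"
    and p: "p \<in> perms srt" and q: "q \<in> perms srt" and eq: "\<And>a. a \<in> S \<Longrightarrow> p \<langle>$\<rangle> a = q \<langle>$\<rangle> a"
  shows "act p x = act q x"
proof -
  let ?r = "inverse q * p"
  have r: "?r \<in> perms srt" using p q by (simp add: perms_times perms_inverse)
  have "act ?r x = x"
    using S r eq by (auto simp: supports_def apply_times)
  then have "act q (act ?r x) = act q x" by simp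
  then show ?thesis
    by (simp add: action_times[OF act q r x] mult.assoc[symmetric])
qed

lemma supports_Int:
  assumes sorts: "\<And>a. infinite {b. srt b = srt a}" and act: "action srt X act" and x: "x \<in> X"
    and S: "finite S" "supports srt act S x" and T: "finite T" "supports srt act T x"
  shows "supports srt act (S \<inter> T) x"
  unfolding supports_def
proof (intro ballI impI)
  fix p assume p: "p \<in> perms srt" and fix_p: "\<forall>a\<in>S \<inter> T. p \<langle>$\<rangle> a = a"
  \<comment> \<open>Move \<open>T - S\<close> out of the way of \<open>p\<close> by a permutation fixing \<open>x\<close>; then \<open>p\<close> on \<open>S\<close> and the identity
    on the image of \<open>T\<close> are compatible.\<close>
  obtain q where q: "q \<in> perms srt" "\<And>a. a \<in> S - (T - S) \<Longrightarrow> q \<langle>$\<rangle> a = a"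
    "\<And>a. a \<in> T - S \<Longrightarrow> q \<langle>$\<rangle> a \<notin> S \<union> Perm.apply p ` S"
    using fresh_renaming[OF sorts, of "T - S" S "S \<union> Perm.apply p ` S"] S(1) T(1) by blast
  have "act q x = x" using S(2) q(1,2) by (auto simp: supports_def)
  with supports_act[OF act q(1) x T(2)] have T': "supports srt act (Perm.apply q ` T) x" by simp
  let ?T = "Perm.apply q ` T"
  have T_cases: "a \<in> S \<inter> T \<or> a \<notin> S \<union> Perm.apply p ` S" if "a \<in> ?T" for a
  proof -
    from that obtain b where b: "b \<in> T" "a = q \<langle>$\<rangle> b" by blast
    show ?thesis
      using b q(2)[of b] q(3)[of b] by (cases "b \<in> S") auto
  qed
  have p_T: "p \<langle>$\<rangle> a = a" if a: "a \<in> S" "p \<langle>$\<rangle> a \<in> ?T" for a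
  proof -
    have "p \<langle>$\<rangle> a \<in> S \<inter> T" using T_cases[OF a(2)] a(1) by blast
    then have "p \<langle>$\<rangle> (p \<langle>$\<rangle> a) = p \<langle>$\<rangle> a" using fix_p by blast
    then show ?thesis by (simp only: apply_inj)
  qed
  obtain r where r: "r \<in> perms srt" "\<And>a. a \<in> S \<Longrightarrow> r \<langle>$\<rangle> a = p \<langle>$\<rangle> a" "\<And>a. a \<in> ?T \<Longrightarrow> r \<langle>$\<rangle> a = a"
  proof (rule perm_fixing[OF p S(1)])
    show "finite ?T" using T(1) by simp
    show "p \<langle>$\<rangle> a = a" if "a \<in> S \<inter> ?T" for a using that T_cases fix_p by blast
  qed (use p_T in blast)+
  have "act p x = act r x"
    by (rule supports_act_cong[OF act x S(2) p r(1)]) (simp add: r(2))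
  also have "act r x = x"
    using T' r(1,3) by (auto simp: supports_def)
  finally show "act p x = x" .
qed

text \<open>A finite supporting set \<open>S\<close> of least cardinality lies in every finite
  supporting set \<open>T\<close>, because \<open>S \<inter> T\<close> supports as well and cannot
  be smaller. Hence the intersection defining \<open>supp\<close> is \<open>S\<close>
  itself.\<close>

lemma finite_supports_supp:
  assumes sorts: "\<And>a. infinite {b. srt b = srt a}" and act: "action srt X act" and x: "x \<in> X"
    and fs: "finitely_supported srt act x"
  shows "finite (supp srt act x)" "supports srt act (supp srt act x) x"
proof -
  let ?P = "\<lambda>S. finite S \<and> supports srt act S x"
  from fs obtain S where S: "?P S" "\<And>T. ?P T \<Longrightarrow> card S \<le> card T"
    unfolding finitely_supported_def by (metis ex_has_least_nat[of ?P _ card])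
  have "S \<subseteq> T" if T: "?P T" for T
  proof -
    have "?P (S \<inter> T)" using supports_Int[OF sorts act x] S(1) T by blast
    then have "card S \<le> card (S \<inter> T)" by (rule S(2))
    then show ?thesis using card_seteq[of S "S \<inter> T"] S(1) by blast
  qed
  then have "supp srt act x = S" using S(1) by (auto simp: supp_def)
  then show "finite (supp srt act x)" "supports srt act (supp srt act x) x" using S(1) by simp_all
qed

lemma nominal_set_finitely_supported:
  "nominal_set srt X act \<Longrightarrow> x \<in> X \<Longrightarrow> finitely_supported srt act x"
  by (simp add: nominal_set_def)

lemma finitely_supported_pair:
  assumes "finitely_supported srt act x" "finitely_supported srt act' y"
  shows "finitely_supported srt (prod_act act act') (x, y)"
proof -
  obtain S T where "finite S" "supports srt act S x" "finite T" "supports srt act' T y"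
    using assms by (auto simp: finitely_supported_def)
  then show ?thesis
    unfolding finitely_supported_def
    by (intro exI[of _ "S \<union> T"]) (auto simp: supports_def prod_act_def)
qed

text \<open>A permutation is determined by its graph on the finitely many names it moves, and a
  countable set has only countably many finite subsets. This makes orbits of formulas
  countable.\<close>

lemma countable_perms:
  assumes "countable (UNIV :: 'n set)"
  shows "countable (UNIV :: 'n perm set)"
proof -
  define graph :: "'n perm \<Rightarrow> ('n \<times> 'n) set" where "graph p = (\<lambda>a. (a, p \<langle>$\<rangle> a)) ` affected p" for p
  have "inj graph"
  proof (rule injI)
    fix p q :: "'n perm" assume eq: "graph p = graph q"
    have mem: "(a, b) \<in> graph p \<longleftrightarrow> p \<langle>$\<rangle> a \<noteq> a \<and> b = p \<langle>$\<rangle> a" for a b p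
      by (auto simp: graph_def in_affected)
    show "p = q"
      by (rule perm_eqI) (metis eq mem)
  qed
  have "countable ((UNIV :: 'n set) \<times> (UNIV :: 'n set))" using assms by (intro countable_SIGMA)
  then have "countable {A. finite A \<and> A \<subseteq> (UNIV :: 'n set) \<times> (UNIV :: 'n set)}"
    by (rule countable_Collect_finite_subset)
  then have "countable (range graph)"
    by (rule countable_subset[rotated]) (auto simp: graph_def)
  then show ?thesis using \<open>inj graph\<close> by (rule countable_image_inj_on)
qed

section \<open>Equivariance of transitions and satisfaction\<close>

lemma abstraction_eqI:
  assumes act: "action srt S act" and X: "X \<in> S" and Y: "Y \<in> S"
    and eq: "alpha_eq srt act (N, X) (M, Y)"
  shows "abstraction srt act N X = abstraction srt act M Y"
proof -
  have "alpha_eq srt act (N, X) Z \<longleftrightarrow> alpha_eq srt act (M, Y) Z" for Z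
    using alpha_eq_trans[OF act X eq, of "fst Z" "snd Z"]
      alpha_eq_trans[OF act Y alpha_eq_sym[OF act X eq], of "fst Z" "snd Z"] by auto
  then show ?thesis by (simp add: abstraction_def)
qed

lemma abstraction_act_abstraction:
  assumes act: "action srt S act" and X: "X \<in> S" and p: "p \<in> perms srt"
  shows "abstraction_act act p (abstraction srt act N X)
    = abstraction srt act (Perm.apply p ` N) (act p X)"
proof -
  \<comment> \<open>Kept general in \<open>p\<close>, \<open>N\<close> and \<open>X\<close>: the
    converse inclusion comes from applying it to \<open>inverse p\<close> and the permuted
    abstraction.\<close>
  have sub: "abstraction_act act p (abstraction srt act N X)
      \<subseteq> abstraction srt act (Perm.apply p ` N) (act p X)" if "X \<in> S" "p \<in> perms srt" for p N X
    using alpha_eq_act[OF act that]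
    by (auto simp: abstraction_def set_act_def prod_act_def)
  have "abstraction srt act (Perm.apply p ` N) (act p X)
      \<subseteq> abstraction_act act p (abstraction srt act N X)"
  proof
    fix Z assume Z: "Z \<in> abstraction srt act (Perm.apply p ` N) (act p X)"
    obtain M Y where MY: "Z = (M, Y)" by fastforce
    have pX: "act p X \<in> S" by (rule action_closed[OF act p X])
    from Z obtain q where q: "q \<in> perms srt" "Y = act q (act p X)"
      by (auto simp: abstraction_def MY elim: alpha_eqE)
    then have Y: "Y \<in> S" using action_closed[OF act _ pX] by simp
    let ?Z = "prod_act (set_act Perm.apply) act (inverse p) Z"
    have "?Z \<in> abstraction_act act (inverse p) (abstraction srt act (Perm.apply p ` N) (act p X))"
      using Z by (simp add: set_act_def)
    then have "?Z \<in> abstraction srt act N X"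
      using sub[OF pX perms_inverse[OF p], of "Perm.apply p ` N"]
      by (auto simp: image_image action_inverse[OF act p X])
    moreover have "Z = prod_act (set_act Perm.apply) act p ?Z"
      by (simp add: MY prod_act_def set_act_def image_image action_inverse[OF act p Y])
    ultimately show "Z \<in> abstraction_act act p (abstraction srt act N X)"
      unfolding set_act_def by blast
  qed
  with sub[OF X p] show ?thesis by blast
qed

section \<open>Equivariance of transitions, freshness and entailment\<close>

context nominal_transition_system
begin

lemma action_STATES: "action srt STATES actS"
  using nominal_STATES by (rule nominal_set_action)

lemma action_act_states: "action srt (ACT \<times> STATES) (prod_act actA actS)"
  using nominal_ACT by (intro action_prod action_STATES nominal_set_action)

lemma supp_state:
  assumes "P \<in> STATES"
  shows "finite (supp srt actS P)" "supports srt actS (supp srt actS P) P"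
  by (rule finite_supports_supp[OF infinite_sorts action_STATES assms
        nominal_set_finitely_supported[OF nominal_STATES assms]])+

lemma step_states: "step P \<alpha> P' \<Longrightarrow> P \<in> STATES \<and> \<alpha> \<in> ACT \<and> P' \<in> STATES"
  using trans_subset by (auto simp: step_def)

lemma step_eqvt:
  assumes "step P \<alpha> P'" "p \<in> perms srt"
  shows "step (actS p P) (actA p \<alpha>) (actS p P')"
proof -
  have mem: "\<alpha> \<in> ACT" "P' \<in> STATES" and "(P, abstraction srt (prod_act actA actS) (bn \<alpha>) (\<alpha>, P')) \<in> trans"
    using assms(1) by (auto simp: step_def)
  from trans_eqvt[OF assms(2) this(3)] mem
  have "(actS p P, abstraction srt (prod_act actA actS) (bn (actA p \<alpha>)) (actA p \<alpha>, actS p P')) \<in> trans"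
    by (simp add: abstraction_act_abstraction[OF action_act_states _ assms(2)] bn_eqvt[OF assms(2)])
      (simp add: prod_act_def set_act_def)
  then show ?thesis
    using mem action_closed[OF action_act_states assms(2), of "(\<alpha>, P')"]
    by (simp add: step_def prod_act_def)
qed

text \<open>The target of a transition is an alpha-class, unchanged when binders are renamed by a
  permutation fixing the free names. The source stays \<open>P\<close> even if \<open>p\<close>
  moves names of \<open>P\<close>.\<close>

lemma step_rename:
  assumes step: "step P \<alpha> P'" and p: "p \<in> perms srt"
    and fix_p: "\<And>a. a \<in> supp srt (prod_act actA actS) (\<alpha>, P') - bn \<alpha> \<Longrightarrow> p \<langle>$\<rangle> a = a"
  shows "step P (actA p \<alpha>) (actS p P')"
proof -
  have mem: "(\<alpha>, P') \<in> ACT \<times> STATES" "(actA p \<alpha>, actS p P') \<in> ACT \<times> STATES"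
    using step_states[OF step] action_closed[OF action_act_states p, of "(\<alpha>, P')"]
    by (auto simp: prod_act_def)
  have "alpha_eq srt (prod_act actA actS) (bn \<alpha>, \<alpha>, P') (bn (actA p \<alpha>), actA p \<alpha>, actS p P')"
    using p fix_p mem by (intro alpha_eqI[of p]) (auto simp: prod_act_def bn_eqvt set_act_def)
  from abstraction_eqI[OF action_act_states mem this] step mem show ?thesis
    by (simp add: step_def)
qed

lemma fresh_eqvt:
  assumes "P \<in> STATES" "p \<in> perms srt" "fresh N P"
  shows "fresh (Perm.apply p ` N) (actS p P)"
  using assms(3) unfolding fresh_def supp_act[OF action_STATES assms(2,1)]
  by (auto simp: apply_inj)

lemma entails_eqvt_iff:
  assumes "P \<in> STATES" "\<phi> \<in> PRED" "p \<in> perms srt"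
  shows "(actS p P, actP p \<phi>) \<in> entails \<longleftrightarrow> (P, \<phi>) \<in> entails"
  using entails_eqvt[OF assms(3), of P \<phi>]
    entails_eqvt[OF perms_inverse[OF assms(3)], of "actS p P" "actP p \<phi>"]
  unfolding action_inverse(1)[OF action_STATES assms(3,1)]
    action_inverse(1)[OF nominal_set_action[OF nominal_PRED] assms(3,2)]
  by blast

end

section \<open>Finite support of formulas and equivariance of satisfaction\<close>

context nominal_logic
begin

text \<open>The constructors are equivariant, so a set supporting the constituents supports the
  formula. For a conjunction this is a support of the set of conjuncts, supplied by the formation
  rule.\<close>

lemma formulas_finitely_supported: "A \<in> formulas \<Longrightarrow> finitely_supported srt form_act A"
proof (induction rule: formulas.induct)
  case (Conj \<A>)
  then have "\<Union>\<A> \<subseteq> RAW" using formulas_RAW by blast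
  then show ?case
    using Conj(3) by (auto simp: finitely_supported_def supports_def form_act_Conj set_act_def)
next
  case (Neg A)
  then show ?case by (auto simp: finitely_supported_def supports_def form_act_Neg)
next
  case (Pred \<phi>)
  then have "finitely_supported srt actP \<phi>"
    by (rule nominal_set_finitely_supported[OF nominal_PRED])
  then show ?case by (auto simp: finitely_supported_def supports_def form_act_Pred Pred_eq_iff)
next
  case (Act \<alpha> A)
  then have "finitely_supported srt (prod_act actA form_act) (\<alpha>, A)"
    by (intro finitely_supported_pair nominal_set_finitely_supported[OF nominal_ACT])
  then show ?case
    using Act formulas_RAW
    by (auto simp: finitely_supported_def supports_def form_act_Act prod_act_def)
qed

lemma supp_act_formula:
  assumes "\<alpha> \<in> ACT" "A \<in> formulas"
  shows "finite (supp srt (prod_act actA form_act) (\<alpha>, A))"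
    "supports srt (prod_act actA form_act) (supp srt (prod_act actA form_act) (\<alpha>, A)) (\<alpha>, A)"
proof -
  have "(\<alpha>, A) \<in> ACT \<times> Pow RAW" using assms formulas_RAW by blast
  moreover have "finitely_supported srt (prod_act actA form_act) (\<alpha>, A)"
    using assms
    by (intro finitely_supported_pair formulas_finitely_supported
        nominal_set_finitely_supported[OF nominal_ACT])
  ultimately show "finite (supp srt (prod_act actA form_act) (\<alpha>, A))"
    "supports srt (prod_act actA form_act) (supp srt (prod_act actA form_act) (\<alpha>, A)) (\<alpha>, A)"
    using finite_supports_supp[OF infinite_sorts action_act_form] by blast+
qed

lemma sat_eqvt:
  "A \<in> formulas \<Longrightarrow> p \<in> perms srt \<Longrightarrow> P \<in> STATES \<Longrightarrow> sat (actS p P) (form_act p A) \<longleftrightarrow> sat P A"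
proof (induction arbitrary: P p rule: formulas.induct)
  case (Conj \<A>)
  have \<A>: "\<A> \<subseteq> formulas" "\<Union>\<A> \<subseteq> RAW" using Conj(1) formulas_RAW by blast+
  have C: "Conj \<A> \<in> formulas" using Conj by (intro formulas.Conj) auto
  have "Conj (form_act p ` \<A>) \<in> formulas"
    using formulas_act[OF C Conj(4)] form_act_Conj[OF Conj(4) \<A>(2)] by simp
  moreover have "form_act p ` \<A> \<subseteq> formulas" using \<A>(1) formulas_act Conj(4) by blast
  ultimately show ?case
    using Conj by (simp add: form_act_Conj[OF Conj(4) \<A>(2)] sat_Conj C \<A>(1))
next
  case (Neg A)
  then show ?case by (simp add: form_act_Neg sat_Neg formulas_act)
next
  case (Pred \<phi>)
  then show ?case
    by (simp add: form_act_Pred sat_Pred action_closed[OF action_PRED] entails_eqvt_iff)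
next
  case (Act \<alpha> A)
  \<comment> \<open>Kept general so that it serves both directions: the converse applies it to
    \<open>inverse p\<close> and the already permuted formula.\<close>
  have fwd: "sat (actS p P) (form_act p X)"
    if X: "X = Act \<beta> B" "\<beta> \<in> ACT" "B \<in> formulas" and p: "p \<in> perms srt" and P: "P \<in> STATES"
      and sat: "sat P X" and IH: "\<And>q P. q \<in> perms srt \<Longrightarrow> P \<in> STATES \<Longrightarrow> sat (actS q P) (form_act q B) \<longleftrightarrow> sat P B"
    for p P X \<beta> B
  proof -
    from sat X obtain \<gamma> C P' where C: "\<gamma> \<in> ACT" "C \<in> formulas"
      "alpha_eq srt (prod_act actA form_act) (bn \<beta>, \<beta>, B) (bn \<gamma>, \<gamma>, C)"
      "fresh (bn \<gamma>) P" "step P \<gamma> P'" "sat P' C"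
      by (auto simp: sat_Act)
    from C(3) X(2) obtain q where q: "q \<in> perms srt" "C = form_act q B"
      by (rule alpha_eq_ActE)
    have P': "P' \<in> STATES" using step_states C(5) by blast
    \<comment> \<open>The induction hypothesis concerns \<open>B\<close>, whereas the witness
      satisfies the renamed formula \<open>C\<close>. Writing \<open>P'\<close> as \<open>q\<close>
      applied to \<open>?P\<close> lets the hypothesis be used once for \<open>q\<close> and once
      for \<open>p * q\<close>.\<close>
    let ?P = "actS (inverse q) P'"
    have P0: "?P \<in> STATES" by (rule action_closed[OF action_STATES perms_inverse[OF q(1)] P'])
    have qP: "actS q ?P = P'" by (rule action_inverse(2)[OF action_STATES q(1) P'])
    have "sat ?P B" using IH[OF q(1) P0] C(6) q(2) qP by simp
    then have "sat (actS (p * q) ?P) (form_act (p * q) B)"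
      using IH[OF perms_times[OF p q(1)] P0] by simp
    then have sat': "sat (actS p P') (form_act p C)"
      using q(2) qP formulas_RAW[OF X(3)]
      by (simp flip: action_times[OF action_STATES p q(1) P0] action_times[OF action_form p q(1)])
    have "form_act p X = Act (actA p \<gamma>) (form_act p C)"
      using X C(1-3) p by (simp add: Act_eqI formulas_RAW form_act_Act Act_eq_iff[symmetric])
    moreover have mem: "actA p \<gamma> \<in> ACT" "form_act p C \<in> formulas"
      using C(1,2) p formulas_act action_closed[OF action_ACT] by auto
    moreover have "fresh (bn (actA p \<gamma>)) (actS p P)"
      using fresh_eqvt[OF P p C(4)] by (simp add: bn_eqvt[OF p C(1)] set_act_def)
    moreover have "alpha_eq srt (prod_act actA form_act) (bn (actA p \<gamma>), actA p \<gamma>, form_act p C)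
        (bn (actA p \<gamma>), actA p \<gamma>, form_act p C)"
      using mem formulas_RAW by (intro alpha_eq_refl[OF action_act_form]) blast
    ultimately show ?thesis
      using step_eqvt[OF C(5) p] sat' by (auto simp: sat_Act)
  qed
  show ?case
  proof
    assume "sat P (Act \<alpha> A)"
    then show "sat (actS p P) (form_act p (Act \<alpha> A))"
      using fwd[OF refl] Act by blast
  next
    assume sat: "sat (actS p P) (form_act p (Act \<alpha> A))"
    let ?\<alpha> = "actA p \<alpha>" and ?A = "form_act p A"
    have A: "A \<in> Pow RAW" using formulas_RAW[OF Act(2)] by simp
    have pA: "?\<alpha> \<in> ACT" "?A \<in> formulas" "actS p P \<in> STATES"
      using Act formulas_act action_closed[OF action_ACT] action_closed[OF action_STATES] by auto
    \<comment> \<open>The hypothesis for \<open>A\<close> transfers to the permuted formula by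
      comparing \<open>q * p\<close> with \<open>p\<close> at the state pulled back along
      \<open>p\<close>.\<close>
    have IH: "sat (actS q R) (form_act q ?A) \<longleftrightarrow> sat R ?A" if q: "q \<in> perms srt" and R: "R \<in> STATES" for q R
    proof -
      let ?R = "actS (inverse p) R"
      have R': "?R \<in> STATES" by (rule action_closed[OF action_STATES perms_inverse[OF Act(4)] R])
      have pR: "actS p ?R = R" by (rule action_inverse(2)[OF action_STATES Act(4) R])
      have "sat (actS (q * p) ?R) (form_act (q * p) A) \<longleftrightarrow> sat (actS p ?R) (form_act p A)"
        using Act.IH R' Act(4) q by (simp add: perms_times)
      then show ?thesis
        by (simp add: pR flip: action_times[OF action_STATES q Act(4) R'] action_times[OF action_form q Act(4) A])
    qed
    have "form_act p (Act \<alpha> A) = Act ?\<alpha> ?A"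
      using A Act by (simp add: form_act_Act)
    from fwd[OF this pA(1,2) perms_inverse[OF Act(4)] pA(3) sat IH]
    show "sat P (Act \<alpha> A)"
      using Act_RAW[OF Act(1)] A
      by (simp add: action_inverse[OF action_STATES Act(4,5)] action_inverse[OF action_form Act(4)])
  qed
qed

section \<open>Logical equivalence is a bisimulation\<close>

text \<open>Satisfaction demands a representative whose binders are fresh for \<open>P\<close>, but
  \<open>bn \<alpha>\<close> need not be. One permutation \<open>p\<close> renames
  \<open>bn \<alpha>\<close> away from \<open>supp P\<close> and fixes the free names of both
  \<open>(\<alpha>, A)\<close> and \<open>(\<alpha>, P')\<close>, so that formula and transition are
  renamed together.\<close>

lemma sat_ActI:
  assumes A: "A \<in> formulas" and step: "step P \<alpha> P'" and sat: "sat P' A"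
  shows "sat P (Act \<alpha> A)"
proof -
  have mem: "P \<in> STATES" "\<alpha> \<in> ACT" "P' \<in> STATES" using step_states[OF step] by auto
  let ?F = "supp srt (prod_act actA form_act) (\<alpha>, A)" and ?G = "supp srt (prod_act actA actS) (\<alpha>, P')"
  have "finitely_supported srt (prod_act actA actS) (\<alpha>, P')"
    using mem by (intro finitely_supported_pair nominal_set_finitely_supported[OF nominal_ACT]
        nominal_set_finitely_supported[OF nominal_STATES])
  then have "finite ?G"
    using finite_supports_supp(1)[OF infinite_sorts action_act_states] mem by blast
  moreover have "finite ?F" using supp_act_formula A mem by blast
  ultimately obtain p where p: "p \<in> perms srt" "\<And>a. a \<in> ?F \<union> ?G - bn \<alpha> \<Longrightarrow> p \<langle>$\<rangle> a = a"
    "\<And>a. a \<in> bn \<alpha> \<Longrightarrow> p \<langle>$\<rangle> a \<notin> supp srt actS P"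
    using fresh_renaming[OF infinite_sorts finite_bn[OF mem(2)], of "?F \<union> ?G" "supp srt actS P"]
      supp_state(1)[OF mem(1)] by blast
  have "alpha_eq srt (prod_act actA form_act) (bn \<alpha>, \<alpha>, A) (bn (actA p \<alpha>), actA p \<alpha>, form_act p A)"
    using p mem by (intro alpha_eqI[of p]) (auto simp: prod_act_def bn_eqvt set_act_def)
  moreover have "fresh (bn (actA p \<alpha>)) P"
    using p(3) by (auto simp: fresh_def bn_eqvt[OF p(1) mem(2)] set_act_def)
  moreover have "step P (actA p \<alpha>) (actS p P')"
    using step_rename[OF step p(1)] p(2) by blast
  moreover have "sat (actS p P') (form_act p A)"
    using sat sat_eqvt[OF A p(1) mem(3)] by simp
  ultimately show ?thesis
    unfolding sat_Act[OF mem(2) A]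
    using formulas_act[OF A p(1)] action_closed[OF action_ACT p(1) mem(2)] by blast
qed

text \<open>The witness may use another representative \<open>(\<beta>, B)\<close>. Undoing the
  renaming by a permutation that fixes \<open>Q\<close> gives a transition of the same state with
  the original label \<open>\<alpha>\<close>.\<close>

lemma sat_ActE:
  assumes A: "A \<in> formulas" and \<alpha>: "\<alpha> \<in> ACT" and Q: "Q \<in> STATES"
    and fresh: "fresh (bn \<alpha>) Q" and sat: "sat Q (Act \<alpha> A)"
  obtains Q' where "step Q \<alpha> Q'" "sat Q' A"
proof -
  from sat obtain \<beta> B R where B: "\<beta> \<in> ACT" "B \<in> formulas"
    "alpha_eq srt (prod_act actA form_act) (bn \<alpha>, \<alpha>, A) (bn \<beta>, \<beta>, B)"
    "fresh (bn \<beta>) Q" "step Q \<beta> R" "sat R B"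
    unfolding sat_Act[OF \<alpha> A] by blast
  let ?F = "supp srt (prod_act actA form_act) (\<alpha>, A)" and ?S = "supp srt actS Q"
  from B(3) obtain p where p: "p \<in> perms srt" "\<forall>a\<in>?F - bn \<alpha>. p \<langle>$\<rangle> a = a"
    "bn \<beta> = Perm.apply p ` bn \<alpha>" "(\<beta>, B) = prod_act actA form_act p (\<alpha>, A)" by (rule alpha_eqE)
  \<comment> \<open>As \<open>bn \<alpha>\<close> and \<open>bn \<beta>\<close> are both fresh for \<open>Q\<close>, some permutation agrees with \<open>p\<close> on \<open>supp (\<alpha>, A)\<close>
    and with the identity on \<open>supp Q\<close>.\<close>
  obtain q where q: "q \<in> perms srt" "\<And>a. a \<in> ?F \<Longrightarrow> q \<langle>$\<rangle> a = p \<langle>$\<rangle> a" "\<And>a. a \<in> ?S \<Longrightarrow> q \<langle>$\<rangle> a = a"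
  proof (rule perm_fixing[OF p(1) supp_act_formula(1)[OF \<alpha> A] supp_state(1)[OF Q]])
    show "p \<langle>$\<rangle> a = a" if "a \<in> ?F \<inter> ?S" for a
      using that p(2) fresh unfolding fresh_def by blast
    \<comment> \<open>A name of \<open>supp Q\<close> is not in \<open>bn \<beta>\<close>, the image
      of \<open>bn \<alpha>\<close> under \<open>p\<close>; hence \<open>a\<close> is not in
      \<open>bn \<alpha>\<close> and \<open>p\<close> fixes it.\<close>
    show "p \<langle>$\<rangle> a = a" if "a \<in> ?F" "p \<langle>$\<rangle> a \<in> ?S" for a
      using that p(2,3) B(4) unfolding fresh_def by blast
  qed blast
  have pair: "(\<alpha>, A) \<in> ACT \<times> Pow RAW" using \<alpha> A formulas_RAW by blast
  have "prod_act actA form_act p (\<alpha>, A) = prod_act actA form_act q (\<alpha>, A)"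
    by (rule supports_act_cong[OF action_act_form pair supp_act_formula(2)[OF \<alpha> A] p(1) q(1)])
      (simp add: q(2))
  then have qA: "\<beta> = actA q \<alpha>" "B = form_act q A" using p(4) by (auto simp: prod_act_def)
  have "actS q Q = Q"
    using supp_state(2)[OF Q] q(1,3) by (auto simp: supports_def)
  then have iQ: "actS (inverse q) Q = Q" using action_inverse(1)[OF action_STATES q(1) Q] by simp
  have R: "R \<in> STATES" using step_states B(5) by blast
  have "step Q \<alpha> (actS (inverse q) R)"
    using step_eqvt[OF B(5) perms_inverse[OF q(1)]]
    by (simp add: iQ qA(1) action_inverse[OF action_ACT q(1) \<alpha>])
  moreover have "sat (actS (inverse q) R) A"
    using sat_eqvt[OF B(2) perms_inverse[OF q(1)] R] B(6) pair
    by (simp add: qA(2) action_inverse[OF action_form q(1)])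
  ultimately show thesis by (rule that)
qed

text \<open>The orbit of a distinguishing formula \<open>A\<close> under the group \<open>G\<close>
  fixing \<open>supp P\<close> is \<open>G\<close>-invariant, so its conjunction is supported by
  \<open>supp P\<close>. Each conjunct holds at \<open>P\<close> by equivariance, as
  \<open>G\<close> fixes \<open>P\<close>, and \<open>A\<close> is itself a conjunct, so
  \<open>Q\<close> fails the conjunction.\<close>

lemma distinguishing_formula:
  assumes P: "P \<in> STATES" and Q: "Q \<in> STATES" and neq: "\<not> logically_equivalent P Q"
  obtains B where "B \<in> formulas" "supports srt form_act (supp srt actS P) B" "sat P B" "\<not> sat Q B"
proof -
  \<comment> \<open>A formula true only at \<open>Q\<close> is replaced by its negation.\<close>
  obtain A where A: "A \<in> formulas" "sat P A" "\<not> sat Q A"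
    using neq formulas.Neg sat_Neg unfolding logically_equivalent_def by metis
  define G where "G = {p \<in> perms srt. \<forall>a\<in>supp srt actS P. p \<langle>$\<rangle> a = a}"
  let ?\<A> = "(\<lambda>p. form_act p A) ` G"
  have RAW: "A \<in> Pow RAW" using formulas_RAW[OF A(1)] by simp
  have formulas: "?\<A> \<subseteq> formulas" using formulas_act[OF A(1)] by (auto simp: G_def)
  have closed: "q * p \<in> G" "inverse q \<in> G" if "p \<in> G" "q \<in> G" for p q
    using that by (auto simp: G_def perms_times perms_inverse apply_times)
      (metis apply_inverse_apply(1))
  have orbit: "form_act q ` ?\<A> = ?\<A>" if q: "q \<in> G" for q
  proof -
    have sub: "form_act q ` ?\<A> \<subseteq> ?\<A>" if "q \<in> G" for q
      using closed(1)[OF _ that] that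
      by (auto simp: G_def action_times[OF action_form _ _ RAW])
    have "?\<A> \<subseteq> form_act q ` ?\<A>"
    proof
      fix B assume B: "B \<in> ?\<A>"
      then have "form_act (inverse q) B \<in> ?\<A>" using sub[OF closed(2)[OF q q]] by blast
      moreover have "form_act q (form_act (inverse q) B) = B"
        using B q formulas formulas_RAW
        by (intro action_inverse(2)[OF action_form]) (auto simp: G_def)
      ultimately show "B \<in> form_act q ` ?\<A>" by (metis imageI)
    qed
    with sub[OF q] show ?thesis by blast
  qed
  \<comment> \<open>Countability of the names, together with \<kappa> being uncountable, keeps the
    orbit small enough for a conjunction.\<close>
  have "countable ?\<A>"
    using countable_perms[OF countable_names] by (meson countable_image countable_subset subset_UNIV)
  then have "|?\<A>| <o \<kappa>"
    using natLeq_less_kappa by (simp add: countable_card_le_natLeq ordLeq_ordLess_trans)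
  moreover have "finitely_supported srt (set_act form_act) ?\<A>"
    unfolding finitely_supported_def
    by (rule exI[of _ "supp srt actS P"])
      (use orbit supp_state(1)[OF P] in \<open>auto simp: supports_def set_act_def G_def\<close>)
  ultimately have C: "Conj ?\<A> \<in> formulas" using formulas by (intro formulas.Conj) auto
  show thesis
  proof (rule that[OF C])
    have "\<Union>?\<A> \<subseteq> RAW" using formulas formulas_RAW by blast
    then show "supports srt form_act (supp srt actS P) (Conj ?\<A>)"
      unfolding supports_def
    proof (intro ballI impI)
      fix q assume q: "q \<in> perms srt" "\<forall>a\<in>supp srt actS P. q \<langle>$\<rangle> a = a"
      then have "q \<in> G" by (simp add: G_def)
      with form_act_Conj[OF q(1) \<open>\<Union>?\<A> \<subseteq> RAW\<close>] orbit
      show "form_act q (Conj ?\<A>) = Conj ?\<A>" by metis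
    qed
    have "sat P (form_act p A)" if "p \<in> G" for p
    proof -
      have "actS p P = P" using that supp_state(2)[OF P] by (auto simp: G_def supports_def)
      then show ?thesis using sat_eqvt[OF A(1) _ P, of p] A(2) that by (simp add: G_def)
    qed
    then show "sat P (Conj ?\<A>)" by (auto simp: sat_Conj[OF C formulas])
    have "1 \<in> G" by (simp add: G_def perms_one)
    then have "A \<in> ?\<A>" using action_one[OF action_form RAW] by force
    then show "\<not> sat Q (Conj ?\<A>)"
      using A(3) unfolding sat_Conj[OF C formulas] by blast
  qed
qed

lemma logically_equivalent_simulation:
  assumes P: "P \<in> STATES" and Q: "Q \<in> STATES" and eq: "logically_equivalent P Q"
    and fresh: "fresh (bn \<alpha>) Q" and step: "step P \<alpha> P'"
  obtains Q' where "step Q \<alpha> Q'" "logically_equivalent P' Q'"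
proof (rule ccontr)
  assume "\<not> thesis"
  with that have neq: "\<not> logically_equivalent P' Q'" if "step Q \<alpha> Q'" for Q' using that by blast
  have P': "P' \<in> STATES" and \<alpha>: "\<alpha> \<in> ACT" using step_states[OF step] by auto
  define D where "D = {Q'. step Q \<alpha> Q'}"
  have D: "D \<subseteq> STATES" using step_states by (auto simp: D_def)
  have "\<forall>Q'\<in>D. \<exists>B. B \<in> formulas \<and> supports srt form_act (supp srt actS P') B \<and> sat P' B \<and> \<not> sat Q' B"
  proof
    fix Q' assume "Q' \<in> D"
    then have "Q' \<in> STATES" "\<not> logically_equivalent P' Q'" using D neq by (auto simp: D_def)
    then show "\<exists>B. B \<in> formulas \<and> supports srt form_act (supp srt actS P') B \<and> sat P' B \<and> \<not> sat Q' B"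
      using distinguishing_formula[OF P'] by blast
  qed
  then obtain B where B: "\<And>Q'. Q' \<in> D \<Longrightarrow> B Q' \<in> formulas"
    "\<And>Q'. Q' \<in> D \<Longrightarrow> supports srt form_act (supp srt actS P') (B Q')"
    "\<And>Q'. Q' \<in> D \<Longrightarrow> sat P' (B Q')" "\<And>Q'. Q' \<in> D \<Longrightarrow> \<not> sat Q' (B Q')"
    by metis
  let ?\<A> = "B ` D"
  have formulas: "?\<A> \<subseteq> formulas" using B(1) by blast
  \<comment> \<open>One formula is chosen per derivative of \<open>Q\<close>, hence at most one per
    state.\<close>
  have "|?\<A>| \<le>o |STATES|"
    using card_of_image[of B D] card_of_mono1[OF D] ordLeq_transitive by blast
  then have "|?\<A>| <o \<kappa>" using STATES_less_kappa ordLeq_ordLess_trans by blast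
  moreover have "finitely_supported srt (set_act form_act) ?\<A>"
    unfolding finitely_supported_def
  proof (intro exI[of _ "supp srt actS P'"] conjI supp_state(1)[OF P'])
    \<comment> \<open>A permutation fixing \<open>supp P'\<close> fixes every member of the family,
      hence the family; supports varying with \<open>Q'\<close> could have an infinite
      union.\<close>
    show "supports srt (set_act form_act) (supp srt actS P') ?\<A>"
      using B(2) by (auto simp: supports_def set_act_def image_image)
  qed
  ultimately have C: "Conj ?\<A> \<in> formulas" using formulas by (intro formulas.Conj) auto
  have "sat P' (Conj ?\<A>)" using B(3) by (auto simp: sat_Conj[OF C formulas])
  then have "sat P (Act \<alpha> (Conj ?\<A>))" by (rule sat_ActI[OF C step])
  then have "sat Q (Act \<alpha> (Conj ?\<A>))"
    using eq formulas.Act[OF \<alpha> C] by (simp add: logically_equivalent_def)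
  then obtain Q' where Q': "step Q \<alpha> Q'" "sat Q' (Conj ?\<A>)"
    by (rule sat_ActE[OF C \<alpha> Q fresh])
  have "Q' \<in> D" using Q'(1) by (simp add: D_def)
  then show False using B(4) Q'(2) unfolding sat_Conj[OF C formulas] by blast
qed

theorem bisimulation_logically_equivalent:
  "bisimulation (\<lambda>P Q. P \<in> STATES \<and> Q \<in> STATES \<and> logically_equivalent P Q)"
  unfolding bisimulation_def
proof (intro conjI allI impI ballI)
  show "symp (\<lambda>P Q. P \<in> STATES \<and> Q \<in> STATES \<and> logically_equivalent P Q)"
    by (auto simp: symp_def logically_equivalent_def)
next
  fix P Q \<phi>
  assume "P \<in> STATES \<and> Q \<in> STATES \<and> logically_equivalent P Q" "\<phi> \<in> PRED" "(P, \<phi>) \<in> entails"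
  then show "(Q, \<phi>) \<in> entails"
    using formulas.Pred sat_Pred unfolding logically_equivalent_def by blast
next
  fix P Q \<alpha> P'
  assume "P \<in> STATES \<and> Q \<in> STATES \<and> logically_equivalent P Q" "fresh (bn \<alpha>) Q \<and> step P \<alpha> P'"
  then show "\<exists>Q'. step Q \<alpha> Q' \<and> P' \<in> STATES \<and> Q' \<in> STATES \<and> logically_equivalent P' Q'"
    using logically_equivalent_simulation step_states by metis
qed auto

end

theorem theorem3p11:
  fixes srt :: "'n \<Rightarrow> 's"
    and STATES :: "'st set" and actS :: "'n perm \<Rightarrow> 'st \<Rightarrow> 'st"
    and PRED :: "'p set" and actP :: "'n perm \<Rightarrow> 'p \<Rightarrow> 'p"
    and ACT :: "'a set" and actA :: "'n perm \<Rightarrow> 'a \<Rightarrow> 'a"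
    and entails :: "('st \<times> 'p) set"
    and bn :: "'a \<Rightarrow> 'n set"
    and trans :: "('st \<times> ('n set \<times> 'a \<times> 'st) set) set"
    and \<kappa> :: "'k rel"
    and P Q :: 'st
  assumes "nominal_transition_system srt STATES actS PRED actP ACT actA entails bn trans"
    and "Card_order \<kappa>" and "natLeq <o \<kappa>" and "|STATES| <o \<kappa>"
    and "P \<in> STATES" and "Q \<in> STATES"
    and "nominal_logic.logically_equivalent srt STATES actS PRED actP ACT actA entails bn trans \<kappa> P Q"
  shows "nominal_transition_system.bisimilar srt STATES actS PRED ACT actA entails bn trans P Q"
proof -
  interpret nominal_logic srt STATES actS PRED actP ACT actA entails bn trans \<kappa>
    using assms(1-4) by (simp add: nominal_logic_def nominal_logic_axioms_def)
  show ?thesis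
    unfolding bisimilar_def using bisimulation_logically_equivalent assms(5-7) by blast
qed

end
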